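(* Let $\theta=\{\theta_k\}_{k\in\mathbb{N}_+}$ be a sequence of real numbers with $\sum_{k=1}^\infty|\theta_k|=1$, let $A_\theta=\{k\in\mathbb{N}_+:\theta_k\ne 0\}$, and let $p^{\theta}$ be the associated linear transition kernel on $G=\{-1,+1\}$, $$p^{\theta}(g\mid \mathbf{w}_{-\infty}^{-1})=\frac12+\frac g2\sum_{k=1}^\infty\theta_k w_{-k}.$$ Suppose that all the following assumptions hold: i) $\gcd(A_\theta)=1$; ii) there exists either an even integer $m\in\mathbb{N}_+$ with $\theta_m<0$, or an odd integer $m_1\in\mathbb{N}_+$ with $\theta_{m_1}<0$ and another odd integer $m_2\in\mathbb{N}_+$ with $\theta_{m_2}>0$; iii) $\sum_{k=1}^\infty\left(\sum_{m=k}^\infty|\theta_m|\right)^2<+\infty$. Then uniqueness holds for $p^\theta$, i.e. $|\mathcal{G}(p^\theta)|=1$.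
   Context: $\mathbb{N}_+=\{1,2,\dots\}$ and $G=\{-1,+1\}$. For a history $\mathbf{w}_{-\infty}^{-1}=(w_{-1},w_{-2},\dots)\in G^{-\mathbb{N}_+}$ and $g\in G$, $p^\theta(g\mid\mathbf{w}_{-\infty}^{-1})$ is given by the formula in the claim; it is a probability measure in $g$. A $G$-valued process $\mathbf{X}=\{X_n,n\in\mathbb{Z}\}$, defined on an arbitrary probability space, is compatible with $p^\theta$ if for every $g\in G$ and every $n\in\mathbb{Z}$, almost surely $P(X_n=g\mid \mathbf{X}_{-\infty}^{n-1})=p^\theta(g\mid\mathbf{X}_{-\infty}^{n-1})$, where $\mathbf{X}_{-\infty}^{n-1}=(X_{n-1},X_{n-2},\dots)$ (so $X_{n-k}$ plays the role of $w_{-k}$). $\mathcal{G}(p^\theta)$ denotes the set of laws on $G^{\mathbb{Z}}$ of processes compatible with $p^\theta$. Uniqueness holds for $p^\theta$ when $|\mathcal{G}(p^\theta)|=1$. *)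

theory Defs
  imports "HOL-Probability.Probability"
begin

definition spins :: "real set" where
  "spins = {-1, 1}"

definition config_space :: "(int \<Rightarrow> real) measure" where
  "config_space = PiM UNIV (\<lambda>_. count_space spins)"

definition history_space :: "(nat \<Rightarrow> real) measure" where
  "history_space = PiM {1..} (\<lambda>_. count_space spins)"

text \<open>A history \<open>w\<close> is indexed so that \<open>w k\<close> is the spin \<open>k\<close> steps in the past, \<open>k \<ge> 1\<close>.
  Likewise only the values \<open>\<theta> k\<close> with \<open>k \<ge> 1\<close> are ever used.\<close>

definition linear_kernel :: "(nat \<Rightarrow> real) \<Rightarrow> real \<Rightarrow> (nat \<Rightarrow> real) \<Rightarrow> real" where
  "linear_kernel \<theta> g w = 1 / 2 + g / 2 * (\<Sum>\<^sub>\<infinity>k\<in>{1..}. \<theta> k * w k)"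

definition nonzero_lags :: "(nat \<Rightarrow> real) \<Rightarrow> nat set" where
  "nonzero_lags \<theta> = {k. k \<ge> 1 \<and> \<theta> k \<noteq> 0}"

definition past :: "(int \<Rightarrow> 'a \<Rightarrow> real) \<Rightarrow> int \<Rightarrow> 'a \<Rightarrow> nat \<Rightarrow> real" where
  "past X n \<omega> = (\<lambda>k\<in>{1..}. X (n - int k) \<omega>)"

definition past_algebra :: "'a measure \<Rightarrow> (int \<Rightarrow> 'a \<Rightarrow> real) \<Rightarrow> int \<Rightarrow> 'a measure" where
  "past_algebra M X n = vimage_algebra (space M) (past X n) history_space"

definition compatible ::
    "'a measure \<Rightarrow> (int \<Rightarrow> 'a \<Rightarrow> real) \<Rightarrow> (real \<Rightarrow> (nat \<Rightarrow> real) \<Rightarrow> real) \<Rightarrow> bool" where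
  "compatible M X p \<longleftrightarrow>
     prob_space M \<and>
     (\<forall>n. X n \<in> measurable M (count_space spins)) \<and>
     (\<forall>g\<in>spins. \<forall>n. AE \<omega> in M.
        real_cond_exp M (past_algebra M X n) (indicator {\<omega> \<in> space M. X n \<omega> = g}) \<omega>
          = p g (past X n \<omega>))"

definition law :: "'a measure \<Rightarrow> (int \<Rightarrow> 'a \<Rightarrow> real) \<Rightarrow> (int \<Rightarrow> real) measure" where
  "law M X = distr M config_space (\<lambda>\<omega> n. X n \<omega>)"

text \<open>A definition cannot quantify over the type of the sample space, so processes are taken on
  probability spaces over \<^typ>\<open>int \<Rightarrow> real\<close>. By the lemma \<open>law_in_compatible_laws\<close>
  below, compatible processes on any other type of sample space contribute no further laws.\<close>

definition compatible_laws ::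
    "(real \<Rightarrow> (nat \<Rightarrow> real) \<Rightarrow> real) \<Rightarrow> (int \<Rightarrow> real) measure set" where
  "compatible_laws p = {law M X | (M :: (int \<Rightarrow> real) measure) X. compatible M X p}"

definition uniqueness_holds :: "(real \<Rightarrow> (nat \<Rightarrow> real) \<Rightarrow> real) \<Rightarrow> bool" where
  "uniqueness_holds p \<longleftrightarrow> card (compatible_laws p) = 1"

lemma measurable_past:
  assumes "\<And>n. X n \<in> measurable M (count_space spins)"
  shows "past X n \<in> measurable M history_space"
  unfolding past_def history_space_def by (intro measurable_restrict assms)

lemma subalgebra_past_algebra:
  assumes "\<And>n. X n \<in> measurable M (count_space spins)"
  shows "subalgebra M (past_algebra M X n)"
  unfolding past_algebra_def subalgebra_def
  using measurable_past[of X M n, OF assms]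
  by (auto simp: measurable_iff_sets)

lemma compatible_law:
  fixes M :: "'a measure"
  assumes comp: "compatible M X p"
    and p: "\<And>g. g \<in> spins \<Longrightarrow> p g \<in> borel_measurable history_space"
  shows "compatible (law M X) (\<lambda>n \<omega>. \<omega> n) p"
proof -
  interpret M: prob_space M using comp by (simp add: compatible_def)
  have X [measurable]: "\<And>n. X n \<in> measurable M (count_space spins)"
    using comp by (simp add: compatible_def)
  define T where "T = (\<lambda>\<omega> n. X n \<omega>)"
  have T [measurable]: "T \<in> measurable M config_space"
    unfolding T_def config_space_def
    by (rule measurable_PiM_single') (use measurable_space[OF X] in auto)
  define L where "L = distr M config_space T"
  have L: "law M X = L" by (simp add: law_def L_def T_def)
  have spL: "space L = space config_space" and seL: "sets L = sets config_space"
    by (simp_all add: L_def)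
  interpret L: prob_space L unfolding L_def by (rule M.prob_space_distr) measurable
  define Y where "Y = (\<lambda>(n::int) (\<omega>::int \<Rightarrow> real). \<omega> n)"
  have Yc: "Y n \<in> measurable config_space (count_space spins)" for n
    unfolding Y_def config_space_def by measurable
  have Y: "Y n \<in> measurable L (count_space spins)" for n
    using Yc[of n] measurable_cong_sets[OF seL refl] by blast
  have pT: "past Y n (T \<omega>) = past X n \<omega>" for n \<omega>
    by (simp add: past_def Y_def T_def)
  have "AE \<omega> in L. real_cond_exp L (past_algebra L Y n) (indicator {\<omega> \<in> space L. Y n \<omega> = g}) \<omega>
          = p g (past Y n \<omega>)" if g: "g \<in> spins" for g n
  proof -
    let ?A = "past_algebra L Y n" and ?B = "past_algebra M X n"
    let ?f = "indicator {\<omega> \<in> space L. Y n \<omega> = g} :: _ \<Rightarrow> real"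
    let ?f' = "indicator {\<omega> \<in> space M. X n \<omega> = g} :: _ \<Rightarrow> real"
    have subA: "subalgebra L ?A" by (rule subalgebra_past_algebra) (rule Y)
    have subB: "subalgebra M ?B" by (rule subalgebra_past_algebra) (rule X)
    interpret A: finite_measure_subalgebra L ?A
      by unfold_locales (rule subA)
    interpret B: finite_measure_subalgebra M ?B
      by unfold_locales (rule subB)
    have EL: "{\<omega> \<in> space L. Y n \<omega> = g} \<in> sets L"
      using measurable_sets[OF Y[of n], of "{g}"] g
      by (auto simp: vimage_def Int_def conj_commute)
    have EM: "{\<omega> \<in> space M. X n \<omega> = g} \<in> sets M"
      using measurable_sets[OF X[of n], of "{g}"] g
      by (auto simp: vimage_def Int_def conj_commute)
    have fM: "integrable M ?f'" by (rule M.integrable_const_bound[where B = 1]) (auto intro: borel_measurable_indicator EM)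
    have fL: "integrable L ?f" by (rule L.integrable_const_bound[where B = 1]) (auto intro: borel_measurable_indicator EL)
    define q where "q = (\<lambda>\<omega>. p g (past Y n \<omega>))"
    have pA: "past Y n \<in> measurable ?A history_space"
      unfolding past_algebra_def
      by (rule measurable_vimage_algebra1) (use measurable_space[OF measurable_past[of Y L n, OF Y]] in auto)
    have qA: "q \<in> borel_measurable ?A"
      unfolding q_def by (rule measurable_compose[OF pA p[OF g]])
    have qL: "q \<in> borel_measurable L"
      by (rule measurable_from_subalg[OF subA qA])
    have qc: "q \<in> borel_measurable config_space"
      using qL measurable_cong_sets[OF seL refl] by blast
    have fc: "?f \<in> borel_measurable config_space"
      using EL seL by simp
    have ae: "AE \<omega> in M. real_cond_exp M ?B ?f' \<omega> = q (T \<omega>)"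
      using comp g by (simp add: compatible_def q_def pT)
    have qTm: "(\<lambda>\<omega>. q (T \<omega>)) \<in> borel_measurable M"
      by (rule measurable_compose[OF T qc])
    have qM: "integrable M (\<lambda>\<omega>. q (T \<omega>))"
      using integrable_cong_AE[OF borel_measurable_cond_exp2 qTm ae] B.real_cond_exp_int(1)[OF fM]
      by blast
    have qi: "integrable L q"
      unfolding L_def by (subst integrable_distr_eq[OF T qc]) (rule qM)
    have "AE \<omega> in L. real_cond_exp L ?A ?f \<omega> = q \<omega>"
    proof (rule A.real_cond_exp_charact[OF _ fL qi qA])
      fix S assume S: "S \<in> sets ?A"
      have "\<exists>H\<in>sets history_space. S = past Y n -` H \<inter> space L"
        using S measurable_past[of Y L n, OF Y] unfolding past_algebra_def
        by (subst (asm) sets_vimage_algebra2) (auto dest: measurable_space)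
      then obtain H where H: "H \<in> sets history_space" and SH: "S = past Y n -` H \<inter> space L" by blast
      define S' where "S' = past X n -` H \<inter> space M"
      have S': "S' \<in> sets ?B"
        unfolding S'_def past_algebra_def by (rule in_vimage_algebra[OF H])
      have Sc: "S \<in> sets config_space"
        using S subA seL by (auto simp: subalgebra_def)
      have iS: "indicator S (T \<omega>) = (indicator S' \<omega> :: real)" if "\<omega> \<in> space M" for \<omega>
        using that measurable_space[OF T that] by (auto simp: SH S'_def pT spL split: split_indicator)
      have fT: "?f (T \<omega>) = ?f' \<omega>" if "\<omega> \<in> space M" for \<omega>
        using that measurable_space[OF T that] by (auto simp: spL Y_def T_def split: split_indicator)
      have "(\<integral>x\<in>S. ?f x \<partial>L) = (\<integral>x. indicator S (T x) * ?f (T x) \<partial>M)"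
        unfolding set_lebesgue_integral_def L_def
        by (subst integral_distr[OF T]) (use Sc fc in \<open>auto simp: L_def\<close>)
      also have "\<dots> = (\<integral>x\<in>S'. ?f' x \<partial>M)"
        unfolding set_lebesgue_integral_def
        by (rule Bochner_Integration.integral_cong) (simp_all only: iS fT real_scaleR_def)
      also have "\<dots> = (\<integral>x\<in>S'. real_cond_exp M ?B ?f' x \<partial>M)"
        by (rule B.real_cond_exp_intA[OF fM S'])
      also have "\<dots> = (\<integral>x\<in>S'. q (T x) \<partial>M)"
      proof -
        have "S' \<in> sets M" using S' subB by (auto simp: subalgebra_def)
        then show ?thesis
          unfolding set_lebesgue_integral_def
          by (intro integral_cong_AE) (use ae qTm in auto)
      qed
      also have "\<dots> = (\<integral>x. indicator S (T x) * q (T x) \<partial>M)"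
        unfolding set_lebesgue_integral_def
        by (rule Bochner_Integration.integral_cong) (simp_all only: iS real_scaleR_def)
      also have "\<dots> = (\<integral>x\<in>S. q x \<partial>L)"
        unfolding set_lebesgue_integral_def L_def
        by (subst integral_distr[OF T]) (use Sc qc in auto)
      finally show "(\<integral>x\<in>S. ?f x \<partial>L) = (\<integral>x\<in>S. q x \<partial>L)" .
    qed
    then show ?thesis by (simp add: q_def)
  qed
  then show ?thesis
    unfolding compatible_def L using L.prob_space_axioms Y by (simp add: Y_def)
qed

lemma law_in_compatible_laws:
  fixes M :: "'a measure"
  assumes comp: "compatible M X p"
    and p: "\<And>g. g \<in> spins \<Longrightarrow> p g \<in> borel_measurable history_space"
  shows "law M X \<in> compatible_laws p"
proof -
  have "law (law M X) (\<lambda>n \<omega>. \<omega> n) = law M X"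
    by (simp add: law_def distr_id2)
  then show ?thesis
    using compatible_law[OF assms] unfolding compatible_laws_def by force
qed

lemma linear_kernel_measurable:
  assumes "(\<lambda>k. \<bar>\<theta> k\<bar>) summable_on {1..}"
  shows "linear_kernel \<theta> g \<in> borel_measurable history_space"
proof -
  define F where "F = (\<lambda>i w. \<Sum>k\<in>{1..i}. \<theta> k * w k :: real)"
  have conv: "(\<lambda>i. F i w) \<longlonglongrightarrow> (\<Sum>\<^sub>\<infinity>k\<in>{1..}. \<theta> k * w k)"
    if w: "w \<in> space history_space" for w
  proof -
    have "\<bar>w k\<bar> = 1" if "k \<ge> 1" for k
    proof -
      have "w k \<in> spins"
        using w that by (auto simp: history_space_def space_PiM PiE_iff)
      then show ?thesis by (auto simp: spins_def)
    qed
    then have "(\<lambda>k. norm (\<theta> k * w k)) summable_on {1..}"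
      by (subst summable_on_cong[where g = "\<lambda>k. \<bar>\<theta> k\<bar>"]) (use assms in \<open>auto simp: abs_mult\<close>)
    then have "(\<lambda>k. \<theta> k * w k) summable_on {1..}" by (rule abs_summable_summable)
    then have "((\<lambda>k. \<theta> k * w k) has_sum (\<Sum>\<^sub>\<infinity>k\<in>{1..}. \<theta> k * w k)) {1..}" by simp
    then have lim: "((\<lambda>S. \<Sum>k\<in>S. \<theta> k * w k) \<longlongrightarrow> (\<Sum>\<^sub>\<infinity>k\<in>{1..}. \<theta> k * w k)) (finite_subsets_at_top {1..})"
      by (simp add: has_sum_def)
    have "filterlim (\<lambda>i. {1..i}) (finite_subsets_at_top {1::nat..}) sequentially"
      unfolding filterlim_finite_subsets_at_top
    proof (intro allI impI)
      fix S :: "nat set" assume S: "finite S \<and> S \<subseteq> {1..}"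
      then obtain b where "\<And>x. x \<in> S \<Longrightarrow> x \<le> b" by (meson finite_nat_set_iff_bounded_le)
      then show "\<forall>\<^sub>F i in sequentially. finite {1..i} \<and> S \<subseteq> {1..i} \<and> {1..i} \<subseteq> {1..}"
        using S by (intro eventually_sequentiallyI[of b]) fastforce
    qed
    from filterlim_compose[OF lim this] show ?thesis by (simp add: F_def)
  qed
  have comp: "(\<lambda>w. w k) \<in> borel_measurable history_space" if "k \<ge> 1" for k
    unfolding history_space_def
    by (rule measurable_compose[OF measurable_component_singleton]) (use that in auto)
  have "F i \<in> borel_measurable history_space" for i
    unfolding F_def by (intro borel_measurable_sum borel_measurable_times borel_measurable_const comp) auto
  with conv have "(\<lambda>w. \<Sum>\<^sub>\<infinity>k\<in>{1..}. \<theta> k * w k) \<in> borel_measurable history_space"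
    by (rule borel_measurable_LIMSEQ_real)
  then have "(\<lambda>w. 1 / 2 + g / 2 * (\<Sum>\<^sub>\<infinity>k\<in>{1..}. \<theta> k * w k)) \<in> borel_measurable history_space"
    by (intro borel_measurable_add borel_measurable_times borel_measurable_const)
  moreover have "linear_kernel \<theta> g = (\<lambda>w. 1 / 2 + g / 2 * (\<Sum>\<^sub>\<infinity>k\<in>{1..}. \<theta> k * w k))"
    by (rule ext) (simp add: linear_kernel_def)
  ultimately show ?thesis by simp
qed

end

(* Given its past, a compatible X_n is distributed as \<epsilon>_k X_{n-k}, where the lag k has law
   |\<theta>_k| and \<epsilon>_k is the sign of \<theta>_k. So each moment E (\<Prod>i\<in>F. X_i) satisfies a linear
   recursion in which the latest site of F jumps back by a random lag, and two sites that meet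
   annihilate. The difference d of the moments of two compatible laws vanishes on the empty set
   and solves this recursion; by induction on card F it is zero:

   - card F = 1: d is bounded and harmonic for a random walk on Z x {-1, 1} whose steps generate
     the group by assumptions i) and ii), hence d = 0 by the Choquet-Deny argument.
   - card F > 1: d is dominated by the probability that two independent renewal processes started
     at different sites never meet. With u_n the probability of a renewal at n, a renewal argument
     bounds (\<Sum>n. u_n^2) times the probability of no further meeting by 1. Since the sum over
     m < n of u_m P(lag \<ge> n - m) equals 1, assumption iii) and Cauchy-Schwarz force
     (\<Sum>n. u_n^2) = \<infinity>, so the processes meet almost surely.

   Existence: the chains started from the constant history 1 at time -N have a finitely additive
   cluster point as N grows, whose finite-dimensional marginals extend by the Kolmogorov theorem. *)

theory Submission
  imports Defs
begin

text \<open>Absolute values in the recursion discard the signs, so for \<open>card F > 1\<close>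
  only the meeting of two chosen lines is used: other lines can at most annihilate, which leads to a
  smaller cardinality, where \<open>d\<close> is already 0. A single line has nothing to meet; there
  the signs must do the work. The no-meeting probability is not built on a path space. It is the
  largest function \<open>escape\<close> of the gap that is at most 1, vanishes at 0, is symmetric
  and is subharmonic for the move from a gap \<open>r > 0\<close> to \<open>r - k\<close>;
  maximality makes it harmonic. The renewal bound decomposes two copies started at 0 by their last
  common renewal before \<open>n\<close>: \<open>pair_escape n\<close>, which is at most 1, equals
  \<kappa> times the sum of u_m^2 over m < n, where \<kappa> is the chance of never meeting again.
  So \<kappa> = 0 and \<open>escape\<close> vanishes at all gaps that the two copies can show; gcd 1
  is what makes these gaps plentiful enough to reach every gap. For existence, convergence of the
  chains is not known beforehand, hence a cluster point. Its mere finite additivity is harmless,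
  because finitely many sites carry finitely many spin patterns.\<close>

text \<open>The least positive element of the subgroup \<open>H\<close> divides every element of
  \<open>A\<close>, by division with remainder, hence divides the gcd. This serves twice: for
  differences of renewal sites and for the signed periods of a harmonic function.\<close>

lemma subgroup_int_one:
  fixes H :: "int set" and A :: "nat set"
  assumes H0: "0 \<in> H" and diff: "\<And>a b. a \<in> H \<Longrightarrow> b \<in> H \<Longrightarrow> a - b \<in> H"
    and A: "\<And>a. a \<in> A \<Longrightarrow> int a \<in> H" and gcd: "Gcd A = 1"
  shows "1 \<in> H"
proof -
  have neg: "- a \<in> H" if "a \<in> H" for a using diff[OF H0 that] by simp
  have add: "a + b \<in> H" if "a \<in> H" "b \<in> H" for a b using diff[OF that(1) neg[OF that(2)]] by simp
  have multn: "int n * a \<in> H" if "a \<in> H" for n a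
    by (induction n) (use H0 that add in \<open>auto simp: algebra_simps\<close>)
  have mult: "m * a \<in> H" if "a \<in> H" for m a
    using multn[OF that, of "nat m"] neg[OF multn[OF that, of "nat (- m)"]] by (cases "m \<ge> 0") auto
  have "\<exists>a\<in>A. a \<noteq> 0"
  proof (rule ccontr)
    assume "\<not> ?thesis"
    then have "Gcd A = 0" by (subst Gcd_0_iff) auto
    with gcd show False by simp
  qed
  then have ex: "\<exists>d. d > 0 \<and> int d \<in> H" using A by blast
  define d where "d = (LEAST d. d > 0 \<and> int d \<in> H)"
  have d: "d > 0" "int d \<in> H" using LeastI_ex[OF ex] by (auto simp: d_def)
  have least: "d \<le> e" if "e > 0" "int e \<in> H" for e
    unfolding d_def by (rule Least_le) (use that in auto)
  have "d dvd a" if "a \<in> A" for a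
  proof -
    have "int a - int (a div d) * int d \<in> H" by (intro diff A that mult d)
    also have "int a - int (a div d) * int d = int (a mod d)"
      by (simp add: zmod_int zdiv_int minus_div_mult_eq_mod)
    finally have "int (a mod d) \<in> H" .
    then have "a mod d = 0" using least[of "a mod d"] d(1) by (meson mod_less_divisor not_le gr0I)
    then show ?thesis by auto
  qed
  then have "d dvd Gcd A" by (rule Gcd_greatest)
  then show ?thesis using gcd d by simp
qed

section \<open>Bounded expectations over a pmf, and a convolution estimate\<close>

lemma integrable_pmf_bounded:
  fixes f :: "'a \<Rightarrow> real"
  assumes "\<And>x. \<bar>f x\<bar> \<le> B"
  shows "integrable (measure_pmf p) f"
  by (rule measure_pmf.integrable_const_bound[where B = B]) (use assms in auto)

lemma abs_expectation_le:
  fixes f :: "'a \<Rightarrow> real"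
  assumes "\<And>x. \<bar>f x\<bar> \<le> B"
  shows "\<bar>measure_pmf.expectation p f\<bar> \<le> B"
proof -
  note [simp] = integrable_pmf_bounded[OF assms, of p]
  have "f x \<le> B" "- B \<le> f x" for x using assms[of x] by auto
  then have "measure_pmf.expectation p f \<le> B" "- B \<le> measure_pmf.expectation p f"
    by (intro measure_pmf.integral_le_const measure_pmf.integral_ge_const; simp)+
  then show ?thesis by simp
qed

lemma expectation_bind_pmf:
  fixes f :: "'b \<Rightarrow> real"
  assumes "\<And>x. \<bar>f x\<bar> \<le> B"
  shows "measure_pmf.expectation (bind_pmf p q) f =
    measure_pmf.expectation p (\<lambda>x. measure_pmf.expectation (q x) f)"
  unfolding measure_pmf_bind
  by (rule integral_bind[where K = "count_space UNIV" and B = B and B' = 1])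
     (use assms measurable_measure_pmf[of q] measure_pmf.emeasure_space_1 in
       \<open>auto simp: measure_pmf.finite_measure\<close>)

lemma expectation_swap_pmf:
  fixes f :: "'a \<Rightarrow> 'b \<Rightarrow> real"
  assumes "\<And>x y. \<bar>f x y\<bar> \<le> B"
  shows "measure_pmf.expectation p (\<lambda>x. measure_pmf.expectation q (f x)) =
    measure_pmf.expectation q (\<lambda>y. measure_pmf.expectation p (\<lambda>x. f x y))"
proof -
  have f: "\<bar>case z of (x, y) \<Rightarrow> f x y\<bar> \<le> B" for z using assms by (cases z) auto
  have "measure_pmf.expectation p (\<lambda>x. measure_pmf.expectation q (f x)) =
    measure_pmf.expectation (bind_pmf p (\<lambda>x. bind_pmf q (\<lambda>y. return_pmf (x, y)))) (\<lambda>(x, y). f x y)"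
    by (simp add: expectation_bind_pmf[OF f])
  also have "\<dots> = measure_pmf.expectation (bind_pmf q (\<lambda>y. bind_pmf p (\<lambda>x. return_pmf (x, y)))) (\<lambda>(x, y). f x y)"
    by (subst bind_commute_pmf) simp
  also have "\<dots> = measure_pmf.expectation q (\<lambda>y. measure_pmf.expectation p (\<lambda>x. f x y))"
    by (simp add: expectation_bind_pmf[OF f])
  finally show ?thesis .
qed

lemma expectation_eq_0_imp_pmf:
  fixes f :: "'a \<Rightarrow> real"
  assumes "\<And>x. 0 \<le> f x" "\<And>x. f x \<le> B" "measure_pmf.expectation p f = 0" "x \<in> set_pmf p"
  shows "f x = 0"
proof -
  have "integrable (measure_pmf p) f" by (rule integrable_pmf_bounded[where B = B]) (use assms in auto)
  then have "AE x in measure_pmf p. f x = 0"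
    using assms integral_nonneg_eq_0_iff_AE[of "measure_pmf p" f] by simp
  then show ?thesis using assms(4) by (simp add: AE_measure_pmf_iff)
qed

text \<open>The convolution of two square-summable sequences tends to 0. The part
  \<open>m < M\<close> vanishes because \<open>t\<close> does; the part \<open>m \<ge> M\<close> is
  small uniformly in \<open>n\<close> by Cauchy-Schwarz.\<close>

lemma convolution_square_summable:
  fixes u t :: "nat \<Rightarrow> real"
  assumes u: "summable (\<lambda>n. (u n)\<^sup>2)" and t: "summable (\<lambda>n. (t n)\<^sup>2)"
  shows "\<exists>n\<ge>1. (\<Sum>m<n. u m * t (n - m)) < 1"
proof -
  define C where "C = (\<Sum>n. (t n)\<^sup>2)"
  have C: "0 \<le> C" unfolding C_def using t by (intro suminf_nonneg) auto
  have tsum: "(\<Sum>m\<in>I. (t (n - m))\<^sup>2) \<le> C" if "I \<subseteq> {..<n}" for I n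
  proof -
    have fin: "finite I" using that finite_subset by blast
    have "(\<Sum>m\<in>I. (t (n - m))\<^sup>2) = (\<Sum>j\<in>(\<lambda>m. n - m) ` I. (t j)\<^sup>2)"
      by (subst sum.reindex) (use that in \<open>auto simp: inj_on_def\<close>)
    also have "\<dots> \<le> C"
      unfolding C_def using t fin by (intro sum_le_suminf) auto
    finally show ?thesis .
  qed
  \<comment> \<open>The threshold makes the Cauchy-Schwarz bound
    \<open>C / (4 * (C + 1)) \<le> (1/2)\<^sup>2\<close>; the added 1 keeps the denominator
    positive.\<close>
  obtain M where M: "(\<Sum>m\<in>{M..<n}. (u m)\<^sup>2) < 1 / (4 * (C + 1))" for n
  proof -
    have "\<exists>N. \<forall>m\<ge>N. \<forall>n. norm (\<Sum>k\<in>{m..<n}. (u k)\<^sup>2) < 1 / (4 * (C + 1))"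
      using u C unfolding summable_Cauchy by force
    then obtain M where "\<And>n. norm (\<Sum>k\<in>{M..<n}. (u k)\<^sup>2) < 1 / (4 * (C + 1))" by blast
    then show ?thesis using that by (metis abs_le_D1 le_less_trans order_refl real_norm_def)
  qed
  have tail: "(\<Sum>m\<in>{M..<n}. u m * t (n - m)) \<le> 1/2" for n
  proof -
    have "(\<Sum>m\<in>{M..<n}. u m * t (n - m))\<^sup>2 \<le> (\<Sum>m\<in>{M..<n}. (u m)\<^sup>2) * (\<Sum>m\<in>{M..<n}. (t (n - m))\<^sup>2)"
      by (rule Cauchy_Schwarz_ineq_sum)
    also have "\<dots> \<le> 1 / (4 * (C + 1)) * C"
      by (intro mult_mono tsum less_imp_le[OF M]) (use C in \<open>auto intro!: sum_nonneg\<close>)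
    also have "\<dots> \<le> (1/2)\<^sup>2" using C by (simp add: field_simps power2_eq_square)
    finally show ?thesis by (rule power2_le_imp_le) simp
  qed
  have "(\<lambda>n. (t n)\<^sup>2) \<longlonglongrightarrow> 0" using t by (rule summable_LIMSEQ_zero)
  then have t0: "t \<longlonglongrightarrow> 0" by simp
  have "(\<lambda>n. \<Sum>m<M. u m * t (n - m)) \<longlonglongrightarrow> (\<Sum>m<M. u m * 0)"
    by (intro tendsto_intros) (rule filterlim_compose[OF t0], rule filterlim_minus_const_nat_at_top)
  then have "(\<lambda>n. \<Sum>m<M. u m * t (n - m)) \<longlonglongrightarrow> 0" by simp
  then have "eventually (\<lambda>n. (\<Sum>m<M. u m * t (n - m)) < 1/2) sequentially"
    by (rule order_tendstoD) simp
  then have "eventually (\<lambda>n. (\<Sum>m<M. u m * t (n - m)) < 1/2 \<and> n \<ge> M + 1) sequentially"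
    using eventually_ge_at_top by (rule eventually_conj)
  then obtain n where n: "(\<Sum>m<M. u m * t (n - m)) < 1/2" "n \<ge> M + 1"
    using eventually_happens by force
  have "{..<n} = {..<M} \<union> {M..<n}" using n by auto
  then have "(\<Sum>m<n. u m * t (n - m)) = (\<Sum>m<M. u m * t (n - m)) + (\<Sum>m\<in>{M..<n}. u m * t (n - m))"
    by (simp add: sum.union_disjoint ivl_disj_int)
  with n tail[of n] have "n \<ge> 1 \<and> (\<Sum>m<n. u m * t (n - m)) < 1" by linarith
  then show ?thesis by blast
qed

subsection \<open>Meetings of independent renewal processes\<close>

text \<open>\<open>K\<close> is the law of the lag, \<epsilon> its sign. The assumption
  \<open>signs\<close> is equivalent to saying that on the support of \<open>K\<close> the sign
  \<epsilon> k coincides neither with 1 nor with (-1)^k, the two characters of the integers with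
  values in {-1, 1}.\<close>

locale signed_renewal =
  fixes K :: "nat pmf" and \<epsilon> :: "nat \<Rightarrow> real"
  assumes K0: "0 \<notin> set_pmf K"
    and abs_\<epsilon>: "\<And>k. \<epsilon> k = 1 \<or> \<epsilon> k = -1"
    and gcd_K: "Gcd (set_pmf K) = 1"
    and signs: "(\<exists>k\<in>set_pmf K. even k \<and> \<epsilon> k = -1) \<or>
      (\<exists>k\<in>set_pmf K. \<exists>l\<in>set_pmf K. odd k \<and> \<epsilon> k = -1 \<and> odd l \<and> \<epsilon> l = 1)"
    and tails: "summable (\<lambda>n. (measure_pmf.prob K {n..})\<^sup>2)"
begin

text \<open>The law of the first site at or after \<open>n\<close> visited by the renewal process
  started at 0. A site is kept until the threshold passes it and only then replaced by a fresh jump,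
  so no trajectory has to be recorded.\<close>

fun first_renewal :: "nat \<Rightarrow> nat pmf" where
  "first_renewal 0 = return_pmf 0"
| "first_renewal (Suc n) = bind_pmf (first_renewal n)
     (\<lambda>a. if a = n then map_pmf (\<lambda>k. n + k) K else return_pmf a)"

definition renewal_mass :: "nat \<Rightarrow> real" where
  "renewal_mass n = pmf (first_renewal n) n"

lemma set_first_renewal_Suc:
  "set_pmf (first_renewal (Suc n)) =
     (set_pmf (first_renewal n) - {n}) \<union> (if n \<in> set_pmf (first_renewal n) then (+) n ` set_pmf K else {})"
  by (auto split: if_splits)

lemma first_renewal_ge: "a \<in> set_pmf (first_renewal n) \<Longrightarrow> n \<le> a"
proof (induction n)
  case (Suc n)
  then show ?case using K0 unfolding set_first_renewal_Suc
    by (fastforce split: if_splits intro: gr0I simp: Suc_le_eq)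
qed simp

text \<open>Raising the threshold moves only the mass sitting at \<open>n\<close>. The later renewal
  identities are sums of such increments.\<close>

lemma expectation_first_renewal_Suc:
  fixes F :: "nat \<Rightarrow> real"
  assumes F: "\<And>a. \<bar>F a\<bar> \<le> B"
  shows "measure_pmf.expectation (first_renewal (Suc n)) F =
    measure_pmf.expectation (first_renewal n) F
    + renewal_mass n * (measure_pmf.expectation K (\<lambda>k. F (n + k)) - F n)"
proof -
  let ?c = "measure_pmf.expectation K (\<lambda>k. F (n + k)) - F n"
  have "measure_pmf.expectation (first_renewal (Suc n)) F =
    measure_pmf.expectation (first_renewal n) (\<lambda>a. F a + ?c * indicator {n} a)"
    by (simp add: expectation_bind_pmf[OF F])
       (intro Bochner_Integration.integral_cong; auto)
  also have "\<dots> = measure_pmf.expectation (first_renewal n) F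
      + measure_pmf.expectation (first_renewal n) (\<lambda>a. ?c * indicator {n} a)"
    by (intro Bochner_Integration.integral_add integrable_pmf_bounded[OF F]
        integrable_pmf_bounded[where B = "\<bar>?c\<bar>"]) (auto simp: indicator_def)
  finally show ?thesis
    by (simp add: renewal_mass_def measure_pmf_single)
qed

text \<open>Decomposition by the last renewal \<open>m\<close> before \<open>n\<close>, whose next
  jump must reach \<open>j\<close>. For \<open>j = n\<close> the left side is 1, which gives the
  renewal equation. In the base case \<open>1 \<le> j\<close> keeps the starting site 0 out of
  \<open>{j..}\<close>.\<close>

lemma prob_first_renewal_ge:
  assumes "n \<le> j" "1 \<le> j"
  shows "measure_pmf.prob (first_renewal n) {j..} =
    (\<Sum>m<n. renewal_mass m * measure_pmf.prob K {j - m..})"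
  using assms(1)
proof (induction n)
  case 0
  then show ?case using assms by simp
next
  case (Suc n)
  have *: "measure_pmf.expectation K (\<lambda>k. indicator {j..} (n + k)) = measure_pmf.prob K {j - n..}"
  proof -
    have "(\<lambda>k. indicator {j..} (n + k) :: real) = indicator {j - n..}"
      by (auto simp: indicator_def fun_eq_iff)
    then show ?thesis by simp
  qed
  have "measure_pmf.prob (first_renewal (Suc n)) {j..} =
    measure_pmf.expectation (first_renewal (Suc n)) (indicator {j..})" by simp
  also have "\<dots> = measure_pmf.prob (first_renewal n) {j..} + renewal_mass n * measure_pmf.prob K {j - n..}"
    by (subst expectation_first_renewal_Suc[where B = 1])
       (use Suc.prems in \<open>auto simp: indicator_def[of _ n] *\<close>)
  finally show ?case using Suc by simp
qed

lemma not_summable_renewal_mass_sq: "\<not> summable (\<lambda>n. (renewal_mass n)\<^sup>2)"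
proof
  assume "summable (\<lambda>n. (renewal_mass n)\<^sup>2)"
  from convolution_square_summable[OF this tails] obtain n where
    n: "n \<ge> 1" "(\<Sum>m<n. renewal_mass m * measure_pmf.prob K {n - m..}) < 1" by blast
  have "measure_pmf.prob (first_renewal n) {n..} = 1"
    by (subst measure_pmf.prob_eq_1) (auto simp: AE_measure_pmf_iff dest: first_renewal_ge)
  with n prob_first_renewal_ge[of n n] show False by simp
qed

section \<open>Integers as differences of renewal sites\<close>

text \<open>The additive monoid generated by the support of \<open>K\<close>: the sites that the
  process started at 0 can reach.\<close>

inductive_set renewals :: "nat set" where
  zero: "0 \<in> renewals"
| step: "\<lbrakk>a \<in> renewals; k \<in> set_pmf K\<rbrakk> \<Longrightarrow> a + k \<in> renewals"

lemma renewals_add: "a \<in> renewals \<Longrightarrow> b \<in> renewals \<Longrightarrow> a + b \<in> renewals"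
  by (rotate_tac, induction rule: renewals.induct) (auto simp: add.assoc[symmetric] intro: renewals.intros)

text \<open>The differences form a group containing the support of \<open>K\<close>, hence 1.
  Multiples of the two sites that represent 1 then represent \<open>z\<close>.\<close>

lemma renewals_difference: "\<exists>a\<in>renewals. \<exists>b\<in>renewals. z = int a - int b"
proof -
  define H where "H = {int a - int b | a b. a \<in> renewals \<and> b \<in> renewals}"
  have HI: "int a - int b \<in> H" if "a \<in> renewals" "b \<in> renewals" for a b
    using that by (auto simp: H_def)
  have diff: "x - y \<in> H" if "x \<in> H" "y \<in> H" for x y
  proof -
    from that obtain a b c e where "x = int a - int b" "y = int c - int e"
      "a \<in> renewals" "b \<in> renewals" "c \<in> renewals" "e \<in> renewals" by (auto simp: H_def)
    moreover from this have "x - y = int (a + e) - int (b + c)" by simp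
    ultimately show ?thesis using HI[of "a + e" "b + c"] by (simp only: renewals_add)
  qed
  have "1 \<in> H"
    by (rule subgroup_int_one[OF _ diff _ gcd_K])
       (use HI[OF renewals.zero renewals.zero] HI[OF renewals.step[OF renewals.zero] renewals.zero] in auto)
  then obtain a b where ab: "1 = int a - int b" "a \<in> renewals" "b \<in> renewals" by (auto simp: H_def)
  have mult: "n * a \<in> renewals" if "a \<in> renewals" for n a
    by (induction n) (auto intro: renewals.zero renewals_add that)
  show ?thesis
  proof (cases "z \<ge> 0")
    case True
    then have "z = int (nat z * a) - int (nat z * b)"
      using arg_cong[OF ab(1), of "(*) z"] by (simp add: algebra_simps)
    then show ?thesis using mult ab by blast
  next
    case False
    then have "z = int (nat (- z) * b) - int (nat (- z) * a)"
      using arg_cong[OF ab(1), of "(*) z"] by (simp add: algebra_simps)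
    then show ?thesis using mult ab by blast
  qed
qed

text \<open>The jump from \<open>a\<close> to \<open>a + k\<close> passes over every threshold
  between the two, so \<open>a + k\<close> remains a possible first renewal for each of
  them.\<close>

lemma first_renewal_support:
  assumes "a \<in> renewals" "k \<in> set_pmf K" "a < n" "n \<le> a + k"
    "a \<in> set_pmf (first_renewal a)"
  shows "a + k \<in> set_pmf (first_renewal n)"
  using assms(3,4)
proof (induction n)
  case (Suc n)
  show ?case
  proof (cases "n = a")
    case True
    then show ?thesis using assms unfolding set_first_renewal_Suc by auto
  next
    case False
    then show ?thesis using Suc unfolding set_first_renewal_Suc by auto
  qed
qed simp

lemma renewals_support: "a \<in> renewals \<Longrightarrow> a \<in> set_pmf (first_renewal a)"
proof (induction rule: renewals.induct)
  case (step a k)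
  then have "k > 0" using K0 by (auto intro: gr0I)
  with step show ?case by (intro first_renewal_support) auto
qed simp

section \<open>The largest subharmonic function of the gap\<close>

text \<open>Here \<open>r\<close> is the gap between two sites; a jump of the later one back by
  \<open>k\<close> turns it into \<open>r - k\<close>. Symmetry covers the case that the jump
  overtakes the other site.\<close>

definition subharmonic :: "(int \<Rightarrow> real) \<Rightarrow> bool" where
  "subharmonic w \<longleftrightarrow> w 0 = 0 \<and> (\<forall>r. 0 \<le> w r \<and> w r \<le> 1 \<and> w (- r) = w r) \<and>
     (\<forall>r>0. w r \<le> measure_pmf.expectation K (\<lambda>k. w (r - int k)))"

text \<open>This is the probability that two lines at gap \<open>r\<close> never meet: along the gap
  walk stopped at 0 every admissible \<open>w\<close> is a submartingale bounded by the indicator of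
  not having met, and the probability itself is admissible.\<close>

definition escape :: "int \<Rightarrow> real" where
  "escape r = (SUP w\<in>Collect subharmonic. w r)"

lemma subharmonicD:
  assumes "subharmonic w"
  shows "w 0 = 0" "0 \<le> w r" "w r \<le> 1" "w (- r) = w r"
    "0 < r \<Longrightarrow> w r \<le> measure_pmf.expectation K (\<lambda>k. w (r - int k))"
  using assms unfolding subharmonic_def by auto

lemma subharmonic_zero: "subharmonic (\<lambda>_. 0)"
  by (simp add: subharmonic_def)

lemma escape_upper: "subharmonic w \<Longrightarrow> w r \<le> escape r"
  unfolding escape_def by (rule cSUP_upper) (auto intro!: bdd_aboveI[where M = 1] dest: subharmonicD)

lemma escape_least: "(\<And>w. subharmonic w \<Longrightarrow> w r \<le> c) \<Longrightarrow> escape r \<le> c"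
  unfolding escape_def by (rule cSUP_least) (use subharmonic_zero in auto)

lemma subharmonic_escape: "subharmonic escape"
  unfolding subharmonic_def
proof (intro conjI allI impI)
  fix r :: int
  show nn: "0 \<le> escape r" for r using escape_upper[OF subharmonic_zero] .
  show le1: "escape r \<le> 1" for r by (rule escape_least) (rule subharmonicD)
  show "escape 0 = 0"
    by (rule antisym[OF escape_least nn]) (simp add: subharmonicD)
  have "escape (- r) \<le> escape r" for r
    by (rule escape_least) (metis subharmonicD(4) escape_upper)
  from this[of r] this[of "- r"] show "escape (- r) = escape r" by simp
  assume r: "0 < r"
  show "escape r \<le> measure_pmf.expectation K (\<lambda>k. escape (r - int k))"
  proof (rule escape_least)
    fix w assume w: "subharmonic w"
    have "w r \<le> measure_pmf.expectation K (\<lambda>k. w (r - int k))" by (rule subharmonicD[OF w]) fact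
    also have "\<dots> \<le> measure_pmf.expectation K (\<lambda>k. escape (r - int k))"
      by (intro integral_mono integrable_pmf_bounded[where B = 1] escape_upper w)
         (use subharmonicD(2,3)[OF w] nn le1 in auto)
    finally show "w r \<le> measure_pmf.expectation K (\<lambda>k. escape (r - int k))" .
  qed
qed

lemmas escape_simps = subharmonicD[OF subharmonic_escape]

lemma abs_escape_le: "\<bar>escape r\<bar> \<le> 1"
  using escape_simps(2,3)[of r] by simp

text \<open>Maximality of \<^const>\<open>escape\<close> turns subharmonicity into harmonicity: one application of
  the transition operator produces another admissible function.\<close>

lemma escape_harmonic:
  assumes "0 < r"
  shows "escape r = measure_pmf.expectation K (\<lambda>k. escape (r - int k))"
proof (rule antisym[OF escape_simps(5)[OF assms]])
  \<comment> \<open>The absolute value keeps the averaged function symmetric, and the value at 0 is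
    reset because averaging destroys it.\<close>
  define w where "w = (\<lambda>r. if r = 0 then 0 else measure_pmf.expectation K (\<lambda>k. escape (\<bar>r\<bar> - int k)))"
  have ge: "escape r \<le> w r" for r
    using escape_simps(1) escape_simps(5)[of r] escape_simps(5)[of "- r"] escape_simps(4)[of r]
    by (cases r "0 :: int" rule: linorder_cases) (auto simp: w_def)
  have w01: "0 \<le> w r" "w r \<le> 1" for r
  proof -
    show "0 \<le> w r" using ge[of r] escape_simps(2)[of r] by linarith
    have "\<bar>measure_pmf.expectation K (\<lambda>k. escape (\<bar>r\<bar> - int k))\<bar> \<le> 1"
      by (intro abs_expectation_le abs_escape_le)
    then show "w r \<le> 1" by (auto simp: w_def)
  qed
  have "subharmonic w"
    unfolding subharmonic_def
  proof (intro conjI allI impI w01)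
    fix r :: int assume r: "0 < r"
    have "w r = measure_pmf.expectation K (\<lambda>k. escape (r - int k))" using r by (simp add: w_def)
    also have "\<dots> \<le> measure_pmf.expectation K (\<lambda>k. w (r - int k))"
      by (intro integral_mono integrable_pmf_bounded[where B = 1] ge abs_escape_le)
         (use w01 in auto)
    finally show "w r \<le> measure_pmf.expectation K (\<lambda>k. w (r - int k))" .
  qed (auto simp: w_def)
  from escape_upper[OF this, of r] show "measure_pmf.expectation K (\<lambda>k. escape (r - int k)) \<le> escape r"
    using assms by (simp add: w_def)
qed

text \<open>The probability that two independent copies started at 0 have no common renewal at or
  after \<open>n\<close>.\<close>

definition pair_escape :: "nat \<Rightarrow> real" where
  "pair_escape n = measure_pmf.expectation (first_renewal n)
     (\<lambda>a. measure_pmf.expectation (first_renewal n) (\<lambda>b. escape (int a - int b)))"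

text \<open>Off the diagonal \<^const>\<open>escape\<close> is harmonic, so moving both processes past site \<open>n\<close>
  changes its expectation only when both have a renewal at \<open>n\<close>.\<close>

lemma pair_escape_Suc:
  "pair_escape (Suc n) = pair_escape n
     + (renewal_mass n)\<^sup>2 * measure_pmf.expectation K (\<lambda>k. escape (int k))"
proof -
  let ?E = measure_pmf.expectation and ?R = "first_renewal n" and ?u = "renewal_mass n"
  define \<kappa> where "\<kappa> = ?E K (\<lambda>k. escape (int k))"
  \<comment> \<open>The effect of moving only the second process past \<open>n\<close> while the
    first one is at \<open>a\<close>: by harmonicity 0 for \<open>a > n\<close>, and \<kappa> for
    \<open>a = n\<close>.\<close>
  define c where "c a = ?E K (\<lambda>k. escape (int a - int (n + k))) - escape (int a - int n)" for a
  define g where "g a = ?E ?R (\<lambda>b. escape (int a - int b))" for a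
  have sym: "escape (int a - int b) = escape (int b - int a)" for a b
    using escape_simps(4)[of "int a - int b"] by simp
  have c_eq: "c a = (if a = n then \<kappa> else 0)" if "a \<ge> n" for a
  proof (cases "a = n")
    case True
    then show ?thesis using escape_simps(1) escape_simps(4)
      by (simp add: c_def \<kappa>_def)
  next
    case False
    then have "0 < int a - int n" using that by simp
    from escape_harmonic[OF this] False show ?thesis
      by (simp add: c_def algebra_simps)
  qed
  have c_bd: "\<bar>c a\<bar> \<le> 2" for a
  proof -
    have "\<bar>?E K (\<lambda>k. escape (int a - int (n + k)))\<bar> \<le> 1"
      by (intro abs_expectation_le abs_escape_le)
    then show ?thesis unfolding c_def using abs_escape_le[of "int a - int n"] by linarith
  qed
  have g_bd: "\<bar>g a\<bar> \<le> 1" for a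
    unfolding g_def by (intro abs_expectation_le abs_escape_le)
  have gc: "?E (first_renewal (Suc n)) (\<lambda>b. escape (int a - int b)) = g a + ?u * c a" for a
    unfolding g_def c_def by (rule expectation_first_renewal_Suc) (rule abs_escape_le)
  have u: "0 \<le> ?u" "?u \<le> 1" by (simp_all add: renewal_mass_def pmf_le_1)
  have Ec: "?E ?R c = ?u * \<kappa>"
  proof -
    have "?E ?R c = ?E ?R (\<lambda>a. \<kappa> * indicator {n} a)"
      by (intro integral_cong_AE) (auto simp: AE_measure_pmf_iff c_eq dest: first_renewal_ge)
    then show ?thesis by (simp add: renewal_mass_def measure_pmf_single)
  qed
  have Kc: "?E K (\<lambda>k. c (n + k)) = 0"
  proof -
    have "?E K (\<lambda>k. c (n + k)) = ?E K (\<lambda>k. 0)"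
      using K0 by (intro integral_cong_AE) (auto simp: AE_measure_pmf_iff c_eq)
    then show ?thesis by simp
  qed
  have gg: "?E K (\<lambda>k. g (n + k)) - g n = ?u * \<kappa>"
  proof -
    have "?E K (\<lambda>k. g (n + k)) = ?E ?R (\<lambda>b. ?E K (\<lambda>k. escape (int b - int (n + k))))"
      unfolding g_def
      by (subst expectation_swap_pmf[where B = 1]) (simp_all only: abs_escape_le sym[of "n + _"])
    moreover have "g n = ?E ?R (\<lambda>b. escape (int b - int n))"
      unfolding g_def by (simp only: sym[of n])
    moreover have "?E ?R (\<lambda>b. ?E K (\<lambda>k. escape (int b - int (n + k)))) - ?E ?R (\<lambda>b. escape (int b - int n)) = ?E ?R c"
      unfolding c_def
      by (intro Bochner_Integration.integral_diff[symmetric] integrable_pmf_bounded[where B = 1]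
          abs_expectation_le abs_escape_le)
    ultimately show ?thesis using Ec by simp
  qed
  have "pair_escape (Suc n) = ?E (first_renewal (Suc n)) (\<lambda>a. g a + ?u * c a)"
    unfolding pair_escape_def gc ..
  also have "\<dots> = ?E ?R (\<lambda>a. g a + ?u * c a)
      + ?u * (?E K (\<lambda>k. g (n + k) + ?u * c (n + k)) - (g n + ?u * c n))"
  proof (rule expectation_first_renewal_Suc[where B = 3])
    fix a
    have "\<bar>?u * c a\<bar> \<le> 1 * 2" unfolding abs_mult using u c_bd[of a] by (intro mult_mono) auto
    then show "\<bar>g a + ?u * c a\<bar> \<le> 3" using g_bd[of a] by linarith
  qed
  also have "?E ?R (\<lambda>a. g a + ?u * c a) = ?E ?R g + ?u * ?E ?R c"
    by (subst Bochner_Integration.integral_add)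
       (auto intro!: integrable_pmf_bounded[OF g_bd] integrable_pmf_bounded[OF c_bd])
  also have "?E K (\<lambda>k. g (n + k) + ?u * c (n + k)) = ?E K (\<lambda>k. g (n + k)) + ?u * ?E K (\<lambda>k. c (n + k))"
    by (subst Bochner_Integration.integral_add)
       (auto intro!: integrable_pmf_bounded[where B = 1, OF g_bd] integrable_pmf_bounded[where B = 2, OF c_bd])
  also have "?E ?R g = pair_escape n" by (simp only: pair_escape_def g_def[symmetric])
  finally have "pair_escape (Suc n) = pair_escape n + ?u * ?E ?R c + ?u * (?E K (\<lambda>k. g (n + k)) - g n - ?u * c n)"
    using Kc by (simp add: algebra_simps)
  \<comment> \<open>Moving the second process contributes \<open>?u * (?u * \<kappa>)\<close>.
    Moving the first one afterwards contributes nothing: its gain \<open>gg\<close> cancels against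
    \<open>?u * c n\<close>.\<close>
  also have "\<dots> = pair_escape n + ?u\<^sup>2 * \<kappa>"
    unfolding gg Ec c_eq[OF order_refl] by (simp add: power2_eq_square algebra_simps)
  finally show ?thesis unfolding \<kappa>_def .
qed

lemma pair_escape_eq:
  "pair_escape n = (\<Sum>m<n. (renewal_mass m)\<^sup>2) * measure_pmf.expectation K (\<lambda>k. escape (int k))"
proof (induction n)
  case 0
  then show ?case by (simp add: pair_escape_def escape_simps(1))
next
  case (Suc n)
  then show ?case by (simp only: pair_escape_Suc) (simp add: algebra_simps)
qed

lemma pair_escape_eq_0: "pair_escape n = 0"
proof -
  let ?\<kappa> = "measure_pmf.expectation K (\<lambda>k. escape (int k))"
  have \<kappa>: "0 \<le> ?\<kappa>" by (simp add: escape_simps(2))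
  have "?\<kappa> = 0"
  proof (rule ccontr)
    assume "?\<kappa> \<noteq> 0"
    with \<kappa> have pos: "0 < ?\<kappa>" by simp
    have "pair_escape n \<le> 1" for n
    proof -
      have "\<bar>pair_escape n\<bar> \<le> 1" unfolding pair_escape_def by (intro abs_expectation_le abs_escape_le)
      then show ?thesis by simp
    qed
    then have "(\<Sum>m<n. (renewal_mass m)\<^sup>2) \<le> 1 / ?\<kappa>" for n
      using pos by (simp add: pair_escape_eq field_simps)
    then have "summable (\<lambda>n. (renewal_mass n)\<^sup>2)"
      by (intro bounded_imp_summable[where B = "1 / ?\<kappa>"]) (simp_all only: lessThan_Suc_atMost[symmetric] zero_le_power2)
    with not_summable_renewal_mass_sq show False by contradiction
  qed
  then show ?thesis by (simp add: pair_escape_eq)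
qed

text \<open>A nonnegative function with expectation 0 vanishes on the support, applied once for each
  of the two copies.\<close>

lemma escape_support:
  assumes "a \<in> set_pmf (first_renewal n)" "b \<in> set_pmf (first_renewal n)"
  shows "escape (int a - int b) = 0"
proof -
  have "measure_pmf.expectation (first_renewal n) (\<lambda>b. escape (int a - int b)) = 0"
  proof (rule expectation_eq_0_imp_pmf[where B = 1, OF _ _ _ assms(1)])
    show "0 \<le> measure_pmf.expectation (first_renewal n) (\<lambda>b. escape (int x - int b))" for x
      by (simp add: escape_simps(2))
    show "measure_pmf.expectation (first_renewal n) (\<lambda>b. escape (int x - int b)) \<le> 1" for x
      using abs_expectation_le[of "\<lambda>b. escape (int x - int b)" 1 "first_renewal n"] abs_escape_le by simp
  qed (use pair_escape_eq_0[of n] in \<open>simp add: pair_escape_def\<close>)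
  then show ?thesis
    by (rule expectation_eq_0_imp_pmf[where B = 1, rotated 2, OF _ assms(2)])
       (auto simp: escape_simps)
qed

text \<open>A gap \<open>r\<close> below some possible lag is shown by two copies with positive
  probability. If no lag exceeds \<open>r\<close>, harmonicity reduces \<open>r\<close> to the
  smaller gaps \<open>r - k\<close>.\<close>

lemma escape_eq_0: "escape r = 0"
proof -
  have pos: "escape (int r) = 0" for r
  proof (induction r rule: less_induct)
    case (less r)
    show ?case
    proof (cases "\<exists>k\<in>set_pmf K. r < k")
      case True
      then obtain k where k: "k \<in> set_pmf K" "r < k" by blast
      \<comment> \<open>The jump from \<open>a\<close> to \<open>a + k = n + r\<close> crosses
        \<open>n\<close>, so \<open>n + r\<close> and \<open>n\<close> are both possible first
        renewals at or after \<open>n\<close>.\<close>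
      from renewals_difference[of "int k - int r"] obtain n a where
        na: "n \<in> renewals" "a \<in> renewals" "int k - int r = int n - int a" by blast
      then have eq: "a + k = n + r" and lt: "a < n" using k by auto
      have "a + k \<in> set_pmf (first_renewal n)"
        by (rule first_renewal_support) (use na k lt eq renewals_support in auto)
      from escape_support[OF this renewals_support[OF na(1)]] eq show ?thesis by simp
    next
      case False
      show ?thesis
      proof (cases "r = 0")
        case True
        then show ?thesis by (simp add: escape_simps)
      next
        case r: False
        then have "escape (int r) = measure_pmf.expectation K (\<lambda>k. escape (int r - int k))"
          by (intro escape_harmonic) simp
        also have "\<dots> = measure_pmf.expectation K (\<lambda>k. 0)"
        proof (intro integral_cong_AE; simp add: AE_measure_pmf_iff; intro ballI)
          fix k assume k: "k \<in> set_pmf K"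
          then have "k \<le> r" "0 < k" using False K0 by (auto simp: not_less intro: gr0I)
          with less.IH[of "r - k"] r show "escape (int r - int k) = 0" by (simp add: of_nat_diff)
        qed
        finally show ?thesis by simp
      qed
    qed
  qed
  show ?thesis
    using pos[of "nat \<bar>r\<bar>"] escape_simps(4)[of r] by (cases "r \<ge> 0") auto
qed

lemma subharmonic_eq_0:
  assumes "subharmonic w"
  shows "w r = 0"
  using escape_upper[OF assms, of r] subharmonicD(2)[OF assms, of r] by (simp add: escape_eq_0)

end

subsection \<open>The moment recursion\<close>

context signed_renewal
begin

lemma abs_\<epsilon>_eq [simp]: "\<bar>\<epsilon> k\<bar> = 1"
  using abs_\<epsilon>[of k] by auto

text \<open>The Choquet-Deny argument: near its supremum, the increment \<open>\<epsilon> k * a (n - k) - a n\<close> stays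
  near its supremum along many steps of size \<open>k\<close>, and these increments telescope.\<close>

lemma bounded_harmonic_step:
  fixes a :: "int \<Rightarrow> real"
  assumes bd: "\<And>n. \<bar>a n\<bar> \<le> B"
    and harm: "\<And>n. a n = measure_pmf.expectation K (\<lambda>k. \<epsilon> k * a (n - int k))"
    and l: "l \<in> set_pmf K"
  shows "a n = \<epsilon> l * a (n - int l)"
proof -
  define f where "f n = \<epsilon> l * a (n - int l) - a n" for n
  define p where "p = pmf K l"
  have p: "0 < p" "p \<le> 1" using l by (auto simp: p_def pmf_positive pmf_le_1)
  have f_bd: "\<bar>f n\<bar> \<le> 2 * B" for n
  proof -
    have "\<bar>\<epsilon> l * a (n - int l)\<bar> \<le> B" using bd by (simp add: abs_mult)
    then show ?thesis using bd[of n] unfolding f_def by linarith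
  qed
  have f_harm: "f n = measure_pmf.expectation K (\<lambda>k. \<epsilon> k * f (n - int k))" for n
  proof -
    have "f n = \<epsilon> l * measure_pmf.expectation K (\<lambda>k. \<epsilon> k * a (n - int l - int k))
        - measure_pmf.expectation K (\<lambda>k. \<epsilon> k * a (n - int k))"
      unfolding f_def by (simp only: harm[symmetric])
    also have "\<dots> = measure_pmf.expectation K (\<lambda>k. \<epsilon> l * (\<epsilon> k * a (n - int l - int k)) - \<epsilon> k * a (n - int k))"
      by (subst Bochner_Integration.integral_diff)
         (auto intro!: integrable_pmf_bounded[where B = B] simp: abs_mult bd)
    also have "\<dots> = measure_pmf.expectation K (\<lambda>k. \<epsilon> k * f (n - int k))"
      by (intro Bochner_Integration.integral_cong) (simp_all add: f_def algebra_simps)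
    finally show ?thesis .
  qed
  define M where "M = (SUP n. \<bar>f n\<bar>)"
  have f_le_M: "\<bar>f n\<bar> \<le> M" for n
    unfolding M_def by (rule cSUP_upper) (use f_bd in \<open>auto intro!: bdd_aboveI[where M = "2 * B"]\<close>)
  have M0: "0 \<le> M" using f_le_M[of 0] by linarith
  \<comment> \<open>If an average of terms bounded by \<open>M\<close> is within \<delta> of
    \<open>M\<close>, then a term of weight at least \<open>p\<close> is within
    \<open>\<delta> / p\<close> of \<open>M\<close>.\<close>
  have step: "M - \<delta> / p \<le> s * \<epsilon> l * f (n - int l)"
    if s: "\<bar>s\<bar> = 1" and near: "M - \<delta> \<le> s * f n" for s n \<delta>
  proof -
    have g: "\<bar>s * \<epsilon> k * f (n - int k)\<bar> \<le> M" for k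
      using f_le_M s by (simp add: abs_mult)
    have int_g: "integrable K (\<lambda>k. s * \<epsilon> k * f (n - int k))"
      by (rule integrable_pmf_bounded[OF g])
    have int_l: "integrable K (indicator {l} :: nat \<Rightarrow> real)"
      by (rule integrable_pmf_bounded[where B = 1]) (simp add: indicator_def)
    have "p * (M - s * \<epsilon> l * f (n - int l)) =
      measure_pmf.expectation K (\<lambda>k. (M - s * \<epsilon> l * f (n - int l)) * indicator {l} k)"
      by (simp add: p_def measure_pmf_single)
    also have "\<dots> \<le> measure_pmf.expectation K (\<lambda>k. M - s * \<epsilon> k * f (n - int k))"
    proof (intro integral_mono)
      fix k
      show "(M - s * \<epsilon> l * f (n - int l)) * indicator {l} k \<le> M - s * \<epsilon> k * f (n - int k)"
        using g[of k] by (auto simp: indicator_def)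
    qed (auto intro!: int_g int_l Bochner_Integration.integrable_diff)
    also have "\<dots> = M - s * f n"
      by (subst Bochner_Integration.integral_diff) (use int_g f_harm[of n] in \<open>simp_all add: mult.assoc\<close>)
    also have "\<dots> \<le> \<delta>" using near by simp
    finally show ?thesis using p by (simp add: field_simps)
  qed
  have "M = 0"
  proof (rule ccontr)
    assume "M \<noteq> 0"
    with M0 have M: "0 < M" by simp
    \<comment> \<open>\<open>J\<close> increments of size at least \<open>M / 2\<close> exceed the
      bound \<open>2 * B\<close> on their telescoping sum. The factor \<open>p ^ J\<close> in
      \<delta> pays for losing a factor 1/p at each of the steps.\<close>
    obtain J :: nat where J: "2 * B < real J * (M / 2)"
      using reals_Archimedean3[of "M / 2"] M by (metis half_gt_zero)
    define \<delta> where "\<delta> = p ^ J * (M / 2)"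
    have \<delta>: "0 < \<delta>" using p M by (simp add: \<delta>_def)
    have "\<exists>n\<in>UNIV. M - \<delta> < \<bar>f n\<bar>"
      using \<delta> unfolding M_def by (subst less_cSUP_iff[symmetric])
        (use f_bd in \<open>auto intro!: bdd_aboveI[where M = "2 * B"]\<close>)
    then obtain n where n: "M - \<delta> < \<bar>f n\<bar>" by blast
    define s where "s = (if f n < 0 then -1 else 1 :: real)"
    have s: "\<bar>s\<bar> = 1" "M - \<delta> \<le> s * f n" using n by (auto simp: s_def)
    define x where "x j = s * \<epsilon> l ^ j" for j
    have x: "\<bar>x j\<bar> = 1" for j using s by (simp add: x_def abs_mult power_abs)
    have it: "M - \<delta> / p ^ j \<le> x j * f (n - int j * int l)" for j
    proof (induction j)
      case (Suc j)
      from step[OF x Suc] show ?case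
        by (simp add: x_def algebra_simps)
    qed (use s in \<open>simp add: x_def\<close>)
    have "real J * (M / 2) = (\<Sum>j<J. M / 2)" by simp
    also have "\<dots> \<le> (\<Sum>j<J. x j * f (n - int j * int l))"
    proof (rule sum_mono)
      fix j assume "j \<in> {..<J}"
      then have "p ^ J \<le> p ^ j" using p by (intro power_decreasing) auto
      then have "\<delta> / p ^ j \<le> M / 2" using p M by (simp add: \<delta>_def field_simps)
      with it[of j] show "M / 2 \<le> x j * f (n - int j * int l)" by linarith
    qed
    also have "\<dots> = (\<Sum>j<J. x (Suc j) * a (n - int (Suc j) * int l) - x j * a (n - int j * int l))"
      by (intro sum.cong) (simp_all add: x_def f_def algebra_simps)
    also have "\<dots> = x J * a (n - int J * int l) - x 0 * a n"
      by (subst sum_lessThan_telescope) simp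
    also have "\<dots> \<le> 2 * B"
    proof -
      have "\<bar>x J * a (n - int J * int l)\<bar> \<le> B" "\<bar>x 0 * a n\<bar> \<le> B" by (simp_all add: abs_mult x bd)
      then show ?thesis by linarith
    qed
    finally show False using J by simp
  qed
  with f_le_M[of n] show ?thesis by (simp add: f_def)
qed

text \<open>The shifts that fix \<open>a\<close> up to a sign form a group containing all lags,
  hence 1. So a shift by k acts as e^k for one sign e; at a lag where \<epsilon> differs from this
  character, the shifted value equals its own negative.\<close>

lemma bounded_harmonic_eq_0:
  fixes a :: "int \<Rightarrow> real"
  assumes bd: "\<And>n. \<bar>a n\<bar> \<le> B"
    and harm: "\<And>n. a n = measure_pmf.expectation K (\<lambda>k. \<epsilon> k * a (n - int k))"
  shows "a n = 0"
proof -
  note step = bounded_harmonic_step[of a B, OF bd harm]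
  define H where "H = {z. \<exists>e. (e = 1 \<or> e = -1) \<and> (\<forall>n. a n = e * a (n - z))}"
  have "1 \<in> H"
  proof (rule subgroup_int_one[OF _ _ _ gcd_K])
    show "0 \<in> H" by (auto simp: H_def)
    show "int k \<in> H" if "k \<in> set_pmf K" for k
      unfolding H_def by (intro CollectI exI[of _ "\<epsilon> k"] conjI allI abs_\<epsilon> step that)
    fix y z assume "y \<in> H" "z \<in> H"
    then obtain e e' where e: "e = 1 \<or> e = -1" "\<And>n. a n = e * a (n - y)"
      and e': "e' = 1 \<or> e' = -1" "\<And>n. a n = e' * a (n - z)" unfolding H_def by blast
    have "a n = (e * e') * a (n - (y - z))" for n
    proof -
      have "a n = e * a (n - y)" by (rule e)
      also have "a (n - y) = e' * a (n - (y - z))"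
        using e'(2)[of "n - (y - z)"] e'(1) by (auto simp: algebra_simps)
      finally show ?thesis by simp
    qed
    moreover have "e * e' = 1 \<or> e * e' = -1" using e(1) e'(1) by auto
    ultimately show "y - z \<in> H" unfolding H_def by blast
  qed
  then obtain e where e: "e = 1 \<or> e = -1" "\<And>n. a n = e * a (n - 1)"
    unfolding H_def by blast
  have pow: "a n = e ^ k * a (n - int k)" for n k
  proof (induction k)
    case (Suc k)
    then show ?case using e(2)[of "n - int k"] by (simp add: algebra_simps)
  qed simp
  \<comment> \<open>An even lag of sign -1 contradicts both characters; of two odd lags with
    opposite signs, one contradicts each.\<close>
  have "\<exists>k\<in>set_pmf K. \<epsilon> k \<noteq> e ^ k"
    using signs
  proof (elim disjE bexE conjE)
    fix k assume "k \<in> set_pmf K" "even k" "\<epsilon> k = -1"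
    then show ?thesis using e(1) by (intro bexI[of _ k]) auto
  next
    fix k l assume *: "k \<in> set_pmf K" "\<epsilon> k = -1" "l \<in> set_pmf K" "odd l" "\<epsilon> l = 1"
    from e(1) show ?thesis
    proof
      assume "e = 1"
      then show ?thesis using * by (intro bexI[of _ k]) auto
    next
      assume "e = -1"
      then show ?thesis using * by (intro bexI[of _ l]) auto
    qed
  qed
  then obtain k where k: "k \<in> set_pmf K" "\<epsilon> k \<noteq> e ^ k" by blast
  then have "\<epsilon> k * a (n - int k) = e ^ k * a (n - int k)"
    using step[OF k(1), of n] pow[of n k] by simp
  with k have "a (n - int k) = 0" by simp
  then show ?thesis using pow[of n k] by simp
qed

end

text \<open>One backward step of coalescing lines: the latest site jumps \<open>k\<close> units back and annihilates
  with a line already present there, since a squared spin is \<open>1\<close>.\<close>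

definition back_step :: "int set \<Rightarrow> nat \<Rightarrow> int set" where
  "back_step F k = (if Max F - int k \<in> F - {Max F} then F - {Max F, Max F - int k}
     else insert (Max F - int k) (F - {Max F}))"

context signed_renewal
begin

text \<open>Fix a pair \<open>b < a\<close> in \<open>F\<close> and let the sites above
  \<open>a\<close> jump until \<open>a\<close> is the latest. An annihilation on the way gives 0 by
  \<open>smaller\<close>, and any other move keeps the pair; finally \<open>a\<close> jumps and the
  gap becomes \<open>r - k\<close>. The supremum over the positions of all other lines leaves a
  function of the gap alone. The inserted 0 gives it a value when no such \<open>F\<close> exists,
  as for \<open>r = 0\<close>.\<close>

lemma moment_difference_subharmonic:
  fixes d :: "int set \<Rightarrow> real"
  assumes bd: "\<And>F. \<bar>d F\<bar> \<le> 1"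
    and rec: "\<And>F. finite F \<Longrightarrow> F \<noteq> {} \<Longrightarrow> d F = measure_pmf.expectation K (\<lambda>k. \<epsilon> k * d (back_step F k))"
    and smaller: "\<And>F. finite F \<Longrightarrow> card F < N \<Longrightarrow> d F = 0"
  defines "w \<equiv> \<lambda>r. Sup (insert 0 {\<bar>d F\<bar> |F. finite F \<and> card F = N \<and> (\<exists>a\<in>F. \<exists>b\<in>F. a \<noteq> b \<and> \<bar>a - b\<bar> = \<bar>r\<bar>)})"
  shows "subharmonic w"
    and "\<And>F a b. finite F \<Longrightarrow> card F = N \<Longrightarrow> a \<in> F \<Longrightarrow> b \<in> F \<Longrightarrow> a \<noteq> b \<Longrightarrow> \<bar>d F\<bar> \<le> w (a - b)"
proof -
  let ?S = "\<lambda>r. insert 0 {\<bar>d F\<bar> |F. finite F \<and> card F = N \<and> (\<exists>a\<in>F. \<exists>b\<in>F. a \<noteq> b \<and> \<bar>a - b\<bar> = \<bar>r :: int\<bar>)}"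
  have bdd: "bdd_above (?S r)" for r
    by (rule bdd_aboveI[where M = 1]) (use bd in auto)
  have w0: "0 \<le> w r" for r
    unfolding w_def by (rule cSup_upper[OF _ bdd]) simp
  have w1: "w r \<le> 1" for r
    unfolding w_def by (rule cSup_least) (use bd in auto)
  show upper: "\<bar>d F\<bar> \<le> w (a - b)"
    if "finite F" "card F = N" "a \<in> F" "b \<in> F" "a \<noteq> b" for F a b
    unfolding w_def by (rule cSup_upper[OF _ bdd]) (use that in auto)
  have least: "w r \<le> c"
    if "0 \<le> c" "\<And>F a b. finite F \<Longrightarrow> card F = N \<Longrightarrow> a \<in> F \<Longrightarrow> b \<in> F \<Longrightarrow> b < a \<Longrightarrow> a - b = r \<Longrightarrow> \<bar>d F\<bar> \<le> c"
      "0 \<le> r" for r c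
    unfolding w_def
  proof (rule cSup_least)
    fix x assume "x \<in> ?S r"
    then consider "x = 0" | F a b where "x = \<bar>d F\<bar>" "finite F" "card F = N" "a \<in> F" "b \<in> F" "a \<noteq> b" "\<bar>a - b\<bar> = \<bar>r\<bar>"
      by auto
    then show "x \<le> c"
    proof cases
      case 2
      show ?thesis
      proof (cases "b < a")
        case True
        then have "a - b = r" using 2 that(3) by linarith
        with True 2 show ?thesis using that(2)[of F a b] by simp
      next
        case False
        then have "a < b" "b - a = r" using 2 that(3) by linarith+
        with 2 show ?thesis using that(2)[of F b a] by simp
      qed
    qed (use that in auto)
  qed simp
  have int_w: "integrable K (\<lambda>k. w (r - int k))" for r
    by (rule integrable_pmf_bounded[where B = 1]) (use w0 w1 in auto)
  have abs_d: "\<bar>d F\<bar> \<le> measure_pmf.expectation K (\<lambda>k. \<bar>d (back_step F k)\<bar>)"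
    if "finite F" "F \<noteq> {}" for F
    using integral_abs_bound[of "measure_pmf K" "\<lambda>k. \<epsilon> k * d (back_step F k)"] rec[OF that] by (simp add: abs_mult)
  have main: "\<bar>d F\<bar> \<le> measure_pmf.expectation K (\<lambda>k. w (r - int k))"
    if "finite F" "card F = N" "a \<in> F" "b \<in> F" "b < a" "a - b = r" for r F a b
    using that
  \<comment> \<open>The measure is the total height above \<open>a\<close>: it drops at each jump
    from above \<open>a\<close>, and sites at or below \<open>a\<close> contribute 0.\<close>
  proof (induction "\<Sum>x\<in>F. nat (x - a)" arbitrary: F rule: less_induct)
    case less
    let ?V = "measure_pmf.expectation K (\<lambda>k. w (r - int k))"
    have V0: "0 \<le> ?V" by (simp add: w0)
    have ne: "F \<noteq> {}" using less.prems by auto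
    have MaxF: "Max F \<in> F" by (rule Max_in) (use less.prems ne in auto)
    have merge: "d (F - {Max F, Max F - int k}) = 0" if "Max F - int k \<in> F - {Max F}" for k
    proof (rule smaller)
      show "card (F - {Max F, Max F - int k}) < N"
        using less.prems(1,2) MaxF that by (intro less_le_trans[OF psubset_card_mono, of F]) auto
    qed (use less.prems in simp)
    have card_move: "card (insert (Max F - int k) (F - {Max F})) = N" if "Max F - int k \<notin> F - {Max F}" for k
      using less.prems(1,2) card_Suc_Diff1[OF less.prems(1) MaxF] that by (subst card_insert_disjoint) auto
    show ?case
    proof (cases "Max F = a")
      case True
      have "\<bar>d F\<bar> \<le> measure_pmf.expectation K (\<lambda>k. \<bar>d (back_step F k)\<bar>)"
        by (rule abs_d) (use less.prems ne in auto)
      also have "\<dots> \<le> ?V"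
      proof (intro integral_mono_AE int_w integrable_pmf_bounded[where B = 1])
        show "AE k in measure_pmf K. \<bar>d (back_step F k)\<bar> \<le> w (r - int k)"
          unfolding AE_measure_pmf_iff
        proof
          fix k assume "k \<in> set_pmf K"
          with K0 have k: "k > 0" by (auto intro: gr0I)
          show "\<bar>d (back_step F k)\<bar> \<le> w (r - int k)"
          proof (cases "Max F - int k \<in> F - {Max F}")
            case merged: True
            then show ?thesis by (simp add: back_step_def merge w0)
          next
            case moved: False
            have "\<bar>d (insert (Max F - int k) (F - {Max F}))\<bar> \<le> w ((Max F - int k) - b)"
              by (rule upper[OF _ card_move[OF moved]]) (use less.prems True moved in auto)
            then show ?thesis using moved k less.prems True by (simp add: back_step_def algebra_simps)
          qed
        qed
      qed (use bd in auto)
      finally show ?thesis .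
    next
      case False
      then have gt: "a < Max F" using less.prems by (simp add: less_le)
      have "\<bar>d F\<bar> \<le> measure_pmf.expectation K (\<lambda>k. \<bar>d (back_step F k)\<bar>)"
        by (rule abs_d) (use less.prems ne in auto)
      also have "\<dots> \<le> measure_pmf.expectation K (\<lambda>k. ?V)"
      proof (intro integral_mono_AE integrable_pmf_bounded[where B = 1])
        show "AE k in measure_pmf K. \<bar>d (back_step F k)\<bar> \<le> ?V"
          unfolding AE_measure_pmf_iff
        proof
          fix k assume "k \<in> set_pmf K"
          with K0 have k: "k > 0" by (auto intro: gr0I)
          show "\<bar>d (back_step F k)\<bar> \<le> ?V"
          proof (cases "Max F - int k \<in> F - {Max F}")
            case merged: True
            then show ?thesis using V0 by (simp add: back_step_def merge)
          next
            case moved: False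
            let ?F = "insert (Max F - int k) (F - {Max F})"
            have "\<bar>d ?F\<bar> \<le> ?V"
            proof (rule less.hyps)
              have "(\<Sum>x\<in>?F. nat (x - a)) = nat (Max F - int k - a) + (\<Sum>x\<in>F - {Max F}. nat (x - a))"
                using less.prems moved by (subst sum.insert) auto
              also have "\<dots> < nat (Max F - a) + (\<Sum>x\<in>F - {Max F}. nat (x - a))"
                using gt k by simp
              also have "\<dots> = (\<Sum>x\<in>F. nat (x - a))"
                using less.prems MaxF by (subst (2) sum.remove[of _ "Max F"]) auto
              finally show "(\<Sum>x\<in>?F. nat (x - a)) < (\<Sum>x\<in>F. nat (x - a))" .
            qed (use less.prems gt card_move[OF moved] in auto)
            then show ?thesis using moved k by (simp add: back_step_def)
          qed
        qed
        show "\<bar>?V\<bar> \<le> 1" by (rule abs_expectation_le) (use w0 w1 in auto)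
      qed (use bd in auto)
      finally show ?thesis by simp
    qed
  qed
  show "subharmonic w"
    unfolding subharmonic_def
  proof (intro conjI allI impI w0 w1)
    have "?S 0 = {0}" by auto
    then show "w 0 = 0" by (simp add: w_def)
    show "w (- r) = w r" for r by (simp add: w_def)
    fix r :: int assume r: "0 < r"
    show "w r \<le> measure_pmf.expectation K (\<lambda>k. w (r - int k))"
      by (rule least) (use r main in \<open>auto simp: w0\<close>)
  qed
qed

lemma moment_difference_eq_0:
  fixes d :: "int set \<Rightarrow> real"
  assumes bd: "\<And>F. \<bar>d F\<bar> \<le> 1" and empty: "d {} = 0"
    and rec: "\<And>F. finite F \<Longrightarrow> F \<noteq> {} \<Longrightarrow> d F = measure_pmf.expectation K (\<lambda>k. \<epsilon> k * d (back_step F k))"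
    and F: "finite F"
  shows "d F = 0"
  using F
proof (induction "card F" arbitrary: F rule: less_induct)
  case less
  consider "F = {}" | n where "F = {n}" | a b where "a \<in> F" "b \<in> F" "a \<noteq> b"
    by blast
  then show ?case
  proof cases
    case 1
    then show ?thesis using empty by simp
  next
    case (2 n)
    have "d {n} = 0"
    proof (rule bounded_harmonic_eq_0[where a = "\<lambda>n. d {n}"])
      show "d {n} = measure_pmf.expectation K (\<lambda>k. \<epsilon> k * d {n - int k})" for n
        by (subst rec) (auto simp: back_step_def)
    qed (rule bd)
    with 2 show ?thesis by simp
  next
    case 3
    have smaller: "d G = 0" if "finite G" "card G < card F" for G
      using less.hyps that by blast
    note w = moment_difference_subharmonic[of d "card F", OF bd rec smaller]
    have "\<bar>d F\<bar> \<le> 0"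
      using w(2)[of F a b] subharmonic_eq_0[OF w(1)] less.prems 3 by simp
    then show ?thesis by simp
  qed
qed

end

subsection \<open>Moments determine the law\<close>

lemma expectation_pmf_swap:
  fixes f :: "'a \<Rightarrow> 'b::countable \<Rightarrow> real"
  assumes M: "finite_measure M" and f: "\<And>k. (\<lambda>x. f x k) \<in> borel_measurable M"
    and bd: "\<And>x k. x \<in> space M \<Longrightarrow> \<bar>f x k\<bar> \<le> B"
  shows "(\<integral>x. measure_pmf.expectation p (f x) \<partial>M) = measure_pmf.expectation p (\<lambda>k. \<integral>x. f x k \<partial>M)"
    and "integrable M (\<lambda>x. measure_pmf.expectation p (f x))"
proof -
  interpret M: finite_measure M by fact
  interpret pair_sigma_finite "measure_pmf p" M by unfold_locales
  interpret fm: finite_measure "measure_pmf p \<Otimes>\<^sub>M M"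
    by (intro finite_measure_pair_measure M.finite_measure_axioms measure_pmf.finite_measure_axioms)
  have "(\<lambda>(k, x). f x k) \<in> borel_measurable (count_space UNIV \<Otimes>\<^sub>M M)"
    by (rule measurable_pair_measure_countable1) (use f in auto)
  then have "(\<lambda>(k, x). f x k) \<in> borel_measurable (measure_pmf p \<Otimes>\<^sub>M M)"
    by (subst measurable_cong_sets[OF sets_pair_measure_cong[OF sets_measure_pmf_count_space refl] refl]) auto
  then have int: "integrable (measure_pmf p \<Otimes>\<^sub>M M) (\<lambda>(k, x). f x k)"
    by (intro fm.integrable_const_bound[where B = B]) (use bd in \<open>auto simp: space_pair_measure\<close>)
  show "(\<integral>x. measure_pmf.expectation p (f x) \<partial>M) = measure_pmf.expectation p (\<lambda>k. \<integral>x. f x k \<partial>M)"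
    using Fubini_integral[OF int] by simp
  show "integrable M (\<lambda>x. measure_pmf.expectation p (f x))"
    using integrable_snd[OF int] by simp
qed

lemma spins_cases: "x \<in> spins \<longleftrightarrow> x = 1 \<or> x = -1"
  by (auto simp: spins_def)

lemma abs_spin: "x \<in> spins \<Longrightarrow> \<bar>x\<bar> = 1"
  by (auto simp: spins_def)

lemma spin_process_borel:
  assumes "X \<in> measurable M (count_space spins)"
  shows "X \<in> borel_measurable M"
  by (rule measurable_compose[OF assms, of "\<lambda>x. x"]) auto

lemma past_spin_measurable:
  assumes X: "\<And>n. X n \<in> measurable M (count_space spins)" and "i < n"
  shows "X i \<in> borel_measurable (past_algebra M X n)"
proof -
  have p: "past X n \<in> measurable (past_algebra M X n) history_space"
    unfolding past_algebra_def
    by (rule measurable_vimage_algebra1) (use measurable_space[OF measurable_past[of X M n, OF X]] in auto)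
  have "(\<lambda>w. w (nat (n - i))) \<in> measurable history_space (count_space spins)"
    unfolding history_space_def by (rule measurable_component_singleton) (use \<open>i < n\<close> in auto)
  then have c: "(\<lambda>w. w (nat (n - i))) \<in> borel_measurable history_space"
    by (rule spin_process_borel)
  have "X i = (\<lambda>\<omega>. past X n \<omega> (nat (n - i)))"
    using \<open>i < n\<close> by (auto simp: past_def fun_eq_iff)
  then show ?thesis using measurable_compose[OF p c] by simp
qed

definition moment :: "'a measure \<Rightarrow> (int \<Rightarrow> 'a \<Rightarrow> real) \<Rightarrow> int set \<Rightarrow> real" where
  "moment M X F = (\<integral>\<omega>. (\<Prod>i\<in>F. X i \<omega>) \<partial>M)"

lemma abs_moment_le:
  assumes "prob_space M" and X: "\<And>n. X n \<in> measurable M (count_space spins)"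
  shows "\<bar>moment M X F\<bar> \<le> 1"
proof -
  interpret prob_space M by fact
  have "\<bar>\<Prod>i\<in>F. X i \<omega>\<bar> \<le> 1" if "\<omega> \<in> space M" for \<omega>
    using abs_spin[OF measurable_space[OF X that, unfolded space_count_space]] by (simp add: abs_prod)
  moreover from this have "integrable M (\<lambda>\<omega>. \<Prod>i\<in>F. X i \<omega>)"
    by (intro integrable_const_bound[where B = 1])
       (auto intro!: borel_measurable_prod[OF spin_process_borel[OF X]])
  ultimately show ?thesis
    unfolding moment_def
    by (intro order_trans[OF integral_abs_bound] integral_le_const) auto
qed

lemma integrable_spin_polynomial:
  assumes "prob_space M" and X: "\<And>n. X n \<in> measurable M (count_space spins)"
  shows "integrable M (\<lambda>\<omega>. (\<Prod>i\<in>G. X i \<omega>) * (\<Prod>j\<in>J. a j + b j * X j \<omega>))"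
proof -
  interpret prob_space M by fact
  have sp: "\<bar>X i \<omega>\<bar> = 1" if "\<omega> \<in> space M" for i \<omega>
    using measurable_space[OF X that] by (simp add: abs_spin)
  show ?thesis
  proof (rule integrable_const_bound[where B = "\<Prod>j\<in>J. \<bar>a j\<bar> + \<bar>b j\<bar>"])
    show "AE \<omega> in M. norm ((\<Prod>i\<in>G. X i \<omega>) * (\<Prod>j\<in>J. a j + b j * X j \<omega>)) \<le> (\<Prod>j\<in>J. \<bar>a j\<bar> + \<bar>b j\<bar>)"
    proof (rule AE_I2)
      fix \<omega> assume \<omega>: "\<omega> \<in> space M"
      have "\<bar>\<Prod>i\<in>G. X i \<omega>\<bar> = 1" by (simp add: abs_prod sp[OF \<omega>])
      moreover have "\<bar>\<Prod>j\<in>J. a j + b j * X j \<omega>\<bar> \<le> (\<Prod>j\<in>J. \<bar>a j\<bar> + \<bar>b j\<bar>)"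
        unfolding abs_prod
      proof (rule prod_mono, rule conjI)
        fix j
        show "\<bar>a j + b j * X j \<omega>\<bar> \<le> \<bar>a j\<bar> + \<bar>b j\<bar>"
          using abs_triangle_ineq[of "a j" "b j * X j \<omega>"] by (simp add: abs_mult sp[OF \<omega>])
      qed simp
      ultimately show "norm ((\<Prod>i\<in>G. X i \<omega>) * (\<Prod>j\<in>J. a j + b j * X j \<omega>)) \<le> (\<Prod>j\<in>J. \<bar>a j\<bar> + \<bar>b j\<bar>)"
        by (simp add: abs_mult)
    qed
  qed (intro borel_measurable_times borel_measurable_prod borel_measurable_add borel_measurable_const spin_process_borel X)
qed

text \<open>The affine factors are expanded one at a time, down to plain moments. \<open>G\<close>
  collects the spins already picked and therefore varies in the induction.\<close>

lemma spin_polynomial_expectation_eq: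
  assumes M: "prob_space M" "prob_space N"
    and X: "\<And>n. X n \<in> measurable M (count_space spins)"
    and Y: "\<And>n. Y n \<in> measurable N (count_space spins)"
    and eq: "\<And>F. finite F \<Longrightarrow> moment M X F = moment N Y F"
    and "finite J" "finite G" "G \<inter> J = {}"
  shows "(\<integral>\<omega>. (\<Prod>i\<in>G. X i \<omega>) * (\<Prod>j\<in>J. a j + b j * X j \<omega>) \<partial>M) =
    (\<integral>\<omega>. (\<Prod>i\<in>G. Y i \<omega>) * (\<Prod>j\<in>J. a j + b j * Y j \<omega>) \<partial>N)"
  using assms(6-8)
proof (induction J arbitrary: G rule: finite_induct)
  case empty
  then show ?case using eq[of G] by (simp add: moment_def)
next
  case (insert j J)
  have split: "(\<integral>\<omega>. (\<Prod>i\<in>G. Z i \<omega>) * (\<Prod>j\<in>insert j J. a j + b j * Z j \<omega>) \<partial>L) =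
      a j * (\<integral>\<omega>. (\<Prod>i\<in>G. Z i \<omega>) * (\<Prod>j\<in>J. a j + b j * Z j \<omega>) \<partial>L)
      + b j * (\<integral>\<omega>. (\<Prod>i\<in>insert j G. Z i \<omega>) * (\<Prod>j\<in>J. a j + b j * Z j \<omega>) \<partial>L)"
    if L: "prob_space L" and Z: "\<And>n. Z n \<in> measurable L (count_space spins)"
    for L :: "'x measure" and Z
  proof -
    have *: "(\<Prod>i\<in>G. Z i \<omega>) * (\<Prod>j\<in>insert j J. a j + b j * Z j \<omega>) =
        a j * ((\<Prod>i\<in>G. Z i \<omega>) * (\<Prod>j\<in>J. a j + b j * Z j \<omega>))
        + b j * ((\<Prod>i\<in>insert j G. Z i \<omega>) * (\<Prod>j\<in>J. a j + b j * Z j \<omega>))" for \<omega>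
      using insert by (simp add: algebra_simps)
    show ?thesis
      unfolding * by (subst Bochner_Integration.integral_add)
        (auto intro!: integrable_mult_right integrable_spin_polynomial[OF L Z] simp del: prod.insert)
  qed
  show ?case
    using insert.IH[of G] insert.IH[of "insert j G"] insert.prems insert.hyps
    by (simp only: split[OF M(1) X] split[OF M(2) Y]) auto
qed

lemma law_measurable:
  assumes X: "\<And>n. X n \<in> measurable M (count_space spins)"
  shows "(\<lambda>\<omega> n. X n \<omega>) \<in> measurable M config_space"
  unfolding config_space_def
  by (rule measurable_PiM_single') (use measurable_space[OF X] X in auto)

text \<open>Every function on {-1, 1} is affine: the indicator of \<open>A j\<close> is interpolated
  from its values at the two spins. The empty product gives the integrand the form of
  \<open>spin_polynomial_expectation_eq\<close> with \<open>G = {}\<close>.\<close>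

lemma emeasure_law_cylinder:
  assumes L: "prob_space L" and Z: "\<And>n. Z n \<in> measurable L (count_space spins)"
  and J: "finite J" and A: "\<And>j. j \<in> J \<Longrightarrow> A j \<in> sets (count_space spins)"
  shows "emeasure (law L Z) (prod_emb UNIV (\<lambda>_. count_space spins) J (Pi\<^sub>E J A)) =
    ennreal (\<integral>\<omega>. (\<Prod>i\<in>{}. Z i \<omega>) * (\<Prod>j\<in>J. (indicator (A j) 1 + indicator (A j) (-1)) / 2
      + (indicator (A j) 1 - indicator (A j) (-1)) / 2 * Z j \<omega>) \<partial>L)"
proof -
  interpret L: prob_space L by fact
  note T = law_measurable[of Z L, OF Z]
  define S where "S = {\<omega> \<in> space L. \<forall>j\<in>J. Z j \<omega> \<in> A j}"
  have zs: "Z j \<omega> = 1 \<or> Z j \<omega> = -1" if "\<omega> \<in> space L" for j \<omega>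
    using measurable_space[OF Z that] by (simp add: spins_cases)
  have emb: "prod_emb UNIV (\<lambda>_. count_space spins) J (Pi\<^sub>E J A) \<in> sets config_space"
    unfolding config_space_def by (intro sets_PiM_I) (use J A in auto)
  have pre: "(\<lambda>\<omega> n. Z n \<omega>) -` prod_emb UNIV (\<lambda>_. count_space spins) J (Pi\<^sub>E J A) \<inter> space L = S"
    using measurable_space[OF Z] unfolding S_def prod_emb_def by (auto simp: PiE_iff)
  have S: "S \<in> sets L"
    using measurable_sets[OF T emb] unfolding pre .
  have "(\<integral>\<omega>. (\<Prod>i\<in>{}. Z i \<omega>) * (\<Prod>j\<in>J. (indicator (A j) 1 + indicator (A j) (-1)) / 2
      + (indicator (A j) 1 - indicator (A j) (-1)) / 2 * Z j \<omega>) \<partial>L) = (\<integral>\<omega>. indicator S \<omega> \<partial>L)"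
  proof (rule Bochner_Integration.integral_cong[OF refl])
    fix \<omega> assume \<omega>: "\<omega> \<in> space L"
    have "(indicator (A j) 1 + indicator (A j) (-1)) / 2
      + (indicator (A j) 1 - indicator (A j) (-1)) / 2 * Z j \<omega> = (indicator (A j) (Z j \<omega>) :: real)" for j
      using zs[OF \<omega>, of j] by (auto simp: field_simps)
    then have "(\<Prod>i\<in>{}. Z i \<omega>) * (\<Prod>j\<in>J. (indicator (A j) 1 + indicator (A j) (-1)) / 2
      + (indicator (A j) 1 - indicator (A j) (-1)) / 2 * Z j \<omega>) = (\<Prod>j\<in>J. indicator (A j) (Z j \<omega>) :: real)"
      by simp
    also have "\<dots> = indicator S \<omega>"
    proof (cases "\<omega> \<in> S")
      case False
      then obtain j where "j \<in> J" "Z j \<omega> \<notin> A j" using \<omega> by (auto simp: S_def)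
      then show ?thesis using J False by (auto intro!: prod_zero bexI[of _ j])
    qed (auto simp: S_def)
    finally show "(\<Prod>i\<in>{}. Z i \<omega>) * (\<Prod>j\<in>J. (indicator (A j) 1 + indicator (A j) (-1)) / 2
      + (indicator (A j) 1 - indicator (A j) (-1)) / 2 * Z j \<omega>) = indicator S \<omega>" .
  qed
  also have "\<dots> = measure L S" using S by simp
  finally show ?thesis
    unfolding law_def by (subst emeasure_distr[OF T emb]) (simp add: pre L.emeasure_eq_measure)
qed

lemma law_eqI:
  assumes M: "prob_space M" "prob_space N"
    and X: "\<And>n. X n \<in> measurable M (count_space spins)"
    and Y: "\<And>n. Y n \<in> measurable N (count_space spins)"
    and eq: "\<And>F. finite F \<Longrightarrow> moment M X F = moment N Y F"
  shows "law M X = law N Y"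
proof -
  let ?C = "\<lambda>_::int. count_space spins"
  show ?thesis
  proof (rule measure_eqI_PiM_infinite)
    show "sets (law M X) = sets (Pi\<^sub>M UNIV ?C)" "sets (law N Y) = sets (Pi\<^sub>M UNIV ?C)"
      by (simp_all add: law_def config_space_def)
    show "finite_measure (law M X)"
      unfolding law_def using prob_space.prob_space_distr[OF M(1) law_measurable[of X M, OF X]]
      by (simp add: prob_space_def)
    fix A and J :: "int set" assume J: "finite J" and A: "\<And>i. i \<in> J \<Longrightarrow> A i \<in> sets (count_space spins)"
    show "emeasure (law M X) (prod_emb UNIV ?C J (Pi\<^sub>E J A)) = emeasure (law N Y) (prod_emb UNIV ?C J (Pi\<^sub>E J A))"
      by (simp only: emeasure_law_cylinder[of M X J A] emeasure_law_cylinder[of N Y J A] M X Y J A)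
         (subst spin_polynomial_expectation_eq[OF M X Y eq J]; simp)
  qed
qed

section \<open>Compatible processes satisfy the moment recursion\<close>

locale linear_chain = signed_renewal +
  fixes \<theta> :: "nat \<Rightarrow> real"
  assumes kernel: "\<And>g w. (\<And>k. 1 \<le> k \<Longrightarrow> \<bar>w k\<bar> \<le> 1) \<Longrightarrow>
    linear_kernel \<theta> g w = 1 / 2 + g / 2 * measure_pmf.expectation K (\<lambda>k. \<epsilon> k * w k)"
    and abs_summable_\<theta>: "(\<lambda>k. \<bar>\<theta> k\<bar>) summable_on {1..}"
begin

lemma kernel_past:
  assumes X: "\<And>n. X n \<in> measurable M (count_space spins)" and "\<omega> \<in> space M"
  shows "linear_kernel \<theta> g (past X n \<omega>) =
    1 / 2 + g / 2 * measure_pmf.expectation K (\<lambda>k. \<epsilon> k * X (n - int k) \<omega>)"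
proof -
  have "linear_kernel \<theta> g (past X n \<omega>) = 1 / 2 + g / 2 * measure_pmf.expectation K (\<lambda>k. \<epsilon> k * past X n \<omega> k)"
  proof (rule kernel)
    fix k :: nat assume "1 \<le> k"
    have "X (n - int k) \<omega> \<in> spins" using measurable_space[OF X \<open>\<omega> \<in> space M\<close>] by simp
    then show "\<bar>past X n \<omega> k\<bar> \<le> 1" using \<open>1 \<le> k\<close> by (auto simp: past_def spins_cases)
  qed
  also have "measure_pmf.expectation K (\<lambda>k. \<epsilon> k * past X n \<omega> k) =
    measure_pmf.expectation K (\<lambda>k. \<epsilon> k * X (n - int k) \<omega>)"
  proof (rule integral_cong_AE)
    have "k \<ge> 1" if "k \<in> set_pmf K" for k
      using that K0 by (auto simp: Suc_le_eq intro: gr0I)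
    then show "AE k in measure_pmf K. \<epsilon> k * past X n \<omega> k = \<epsilon> k * X (n - int k) \<omega>"
      by (simp add: AE_measure_pmf_iff past_def)
  qed auto
  finally show ?thesis .
qed

text \<open>\<open>X n\<close> is the difference of the indicators of its two values, so its
  conditional mean is the kernel at 1 minus the kernel at -1, that is, the signed average over lags.
  \<open>Y\<close> is known from the past and can be multiplied in; Fubini then exchanges lag and
  process.\<close>

lemma compatible_moment_step:
  assumes comp: "compatible M X (linear_kernel \<theta>)"
    and Y: "Y \<in> borel_measurable (past_algebra M X n)" and bd: "\<And>\<omega>. \<omega> \<in> space M \<Longrightarrow> \<bar>Y \<omega>\<bar> \<le> 1"
  shows "(\<integral>\<omega>. X n \<omega> * Y \<omega> \<partial>M) =
    measure_pmf.expectation K (\<lambda>k. \<epsilon> k * (\<integral>\<omega>. X (n - int k) \<omega> * Y \<omega> \<partial>M))"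
proof -
  interpret prob_space M using comp by (simp add: compatible_def)
  have X: "\<And>n. X n \<in> measurable M (count_space spins)" using comp by (simp add: compatible_def)
  note Xb = spin_process_borel[OF X]
  let ?F = "past_algebra M X n"
  have sub: "subalgebra M ?F" by (rule subalgebra_past_algebra) (rule X)
  interpret F: finite_measure_subalgebra M ?F by unfold_locales (rule sub)
  have YM: "Y \<in> borel_measurable M" by (rule measurable_from_subalg[OF sub Y])
  have sp: "X i \<omega> = 1 \<or> X i \<omega> = -1" if "\<omega> \<in> space M" for i \<omega>
    using measurable_space[OF X that] by (simp add: spins_cases)
  define E where "E g = {\<omega> \<in> space M. X n \<omega> = g}" for g
  have E: "E g \<in> sets M" for g unfolding E_def using Xb by measurable
  define q where "q \<omega> = measure_pmf.expectation K (\<lambda>k. \<epsilon> k * X (n - int k) \<omega>)" for \<omega>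
  have int_YE: "integrable M (\<lambda>\<omega>. Y \<omega> * indicator (E g) \<omega>)" for g
    by (rule integrable_const_bound[where B = 1]) (use YM E bd in \<open>auto simp: indicator_def\<close>)
  have int_q: "integrable M (\<lambda>\<omega>. measure_pmf.expectation K (\<lambda>k. \<epsilon> k * (X (n - int k) \<omega> * Y \<omega>)))"
    and swap: "(\<integral>\<omega>. measure_pmf.expectation K (\<lambda>k. \<epsilon> k * (X (n - int k) \<omega> * Y \<omega>)) \<partial>M) =
      measure_pmf.expectation K (\<lambda>k. \<integral>\<omega>. \<epsilon> k * (X (n - int k) \<omega> * Y \<omega>) \<partial>M)"
  proof -
    have 1: "(\<lambda>\<omega>. \<epsilon> k * (X (n - int k) \<omega> * Y \<omega>)) \<in> borel_measurable M" for k
      using Xb YM by measurable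
    have 2: "\<bar>\<epsilon> k * (X (n - int k) \<omega> * Y \<omega>)\<bar> \<le> 1" if "\<omega> \<in> space M" for \<omega> k
      using bd[OF that] sp[OF that, of "n - int k"] by (auto simp: abs_mult)
    show "integrable M (\<lambda>\<omega>. measure_pmf.expectation K (\<lambda>k. \<epsilon> k * (X (n - int k) \<omega> * Y \<omega>)))"
      by (rule expectation_pmf_swap(2)[OF finite_measure_axioms 1 2])
    show "(\<integral>\<omega>. measure_pmf.expectation K (\<lambda>k. \<epsilon> k * (X (n - int k) \<omega> * Y \<omega>)) \<partial>M) =
      measure_pmf.expectation K (\<lambda>k. \<integral>\<omega>. \<epsilon> k * (X (n - int k) \<omega> * Y \<omega>) \<partial>M)"
      by (rule expectation_pmf_swap(1)[OF finite_measure_axioms 1 2])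
  qed
  have qY: "measure_pmf.expectation K (\<lambda>k. \<epsilon> k * (X (n - int k) \<omega> * Y \<omega>)) = q \<omega> * Y \<omega>" for \<omega>
    by (simp add: q_def flip: mult.assoc)
  have int_Y: "integrable M Y" by (rule integrable_const_bound[where B = 1]) (use YM bd in auto)
  have cond: "(\<integral>\<omega>. Y \<omega> * indicator (E g) \<omega> \<partial>M) = (\<integral>\<omega>. Y \<omega> / 2 + g / 2 * (q \<omega> * Y \<omega>) \<partial>M)" if "g \<in> spins" for g
  proof -
    have "(\<integral>\<omega>. Y \<omega> * indicator (E g) \<omega> \<partial>M) = (\<integral>\<omega>. Y \<omega> * real_cond_exp M ?F (indicator (E g)) \<omega> \<partial>M)"
      by (rule F.real_cond_exp_intg(2)[symmetric]) (use int_YE Y E in auto)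
    also have "\<dots> = (\<integral>\<omega>. Y \<omega> / 2 + g / 2 * (q \<omega> * Y \<omega>) \<partial>M)"
    proof (rule integral_cong_AE)
      have "AE \<omega> in M. real_cond_exp M ?F (indicator (E g)) \<omega> = linear_kernel \<theta> g (past X n \<omega>)"
        using comp that by (simp add: compatible_def E_def)
      then show "AE \<omega> in M. Y \<omega> * real_cond_exp M ?F (indicator (E g)) \<omega> = Y \<omega> / 2 + g / 2 * (q \<omega> * Y \<omega>)"
      proof (rule AE_mp, intro AE_I2 impI)
        fix \<omega> assume "\<omega> \<in> space M" "real_cond_exp M ?F (indicator (E g)) \<omega> = linear_kernel \<theta> g (past X n \<omega>)"
        then show "Y \<omega> * real_cond_exp M ?F (indicator (E g)) \<omega> = Y \<omega> / 2 + g / 2 * (q \<omega> * Y \<omega>)"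
          using kernel_past[OF X] by (simp add: q_def algebra_simps)
      qed
      show "(\<lambda>\<omega>. Y \<omega> / 2 + g / 2 * (q \<omega> * Y \<omega>)) \<in> borel_measurable M"
        using int_q YM unfolding qY by (auto dest: borel_measurable_integrable)
    qed (use YM in auto)
    finally show ?thesis .
  qed
  have "(\<integral>\<omega>. X n \<omega> * Y \<omega> \<partial>M) = (\<integral>\<omega>. Y \<omega> * indicator (E 1) \<omega> - Y \<omega> * indicator (E (-1)) \<omega> \<partial>M)"
  proof (rule Bochner_Integration.integral_cong[OF refl])
    fix \<omega> assume "\<omega> \<in> space M"
    then show "X n \<omega> * Y \<omega> = Y \<omega> * indicator (E 1) \<omega> - Y \<omega> * indicator (E (-1)) \<omega>"
      using sp[of \<omega> n] by (auto simp: E_def)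
  qed
  also have "\<dots> = (\<integral>\<omega>. Y \<omega> / 2 + 1 / 2 * (q \<omega> * Y \<omega>) \<partial>M) - (\<integral>\<omega>. Y \<omega> / 2 + (-1) / 2 * (q \<omega> * Y \<omega>) \<partial>M)"
    by (subst Bochner_Integration.integral_diff[OF int_YE int_YE]) (simp add: cond spins_def)
  also have "\<dots> = (\<integral>\<omega>. q \<omega> * Y \<omega> \<partial>M)"
    using int_Y int_q unfolding qY by simp
  also have "\<dots> = measure_pmf.expectation K (\<lambda>k. \<epsilon> k * (\<integral>\<omega>. X (n - int k) \<omega> * Y \<omega> \<partial>M))"
    using swap unfolding qY by simp
  finally show ?thesis .
qed

text \<open>All sites of \<open>F\<close> but the latest lie in its past, so their product can serve
  as \<open>Y\<close>. A lag landing on one of them squares its spin to 1.\<close>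

lemma compatible_moment_rec:
  assumes comp: "compatible M X (linear_kernel \<theta>)" and F: "finite F" "F \<noteq> {}"
  shows "moment M X F = measure_pmf.expectation K (\<lambda>k. \<epsilon> k * moment M X (back_step F k))"
proof -
  interpret prob_space M using comp by (simp add: compatible_def)
  have X: "\<And>n. X n \<in> measurable M (count_space spins)" using comp by (simp add: compatible_def)
  have sp: "X i \<omega> = 1 \<or> X i \<omega> = -1" if "\<omega> \<in> space M" for i \<omega>
    using measurable_space[OF X that] by (simp add: spins_cases)
  let ?n = "Max F" and ?G = "F - {Max F}"
  define Y where "Y \<omega> = (\<Prod>i\<in>?G. X i \<omega>)" for \<omega>
  have Max: "?n \<in> F" using F by simp
  have lt: "i < ?n" if "i \<in> ?G" for i using F that Max_ge[of F i] by (simp add: less_le)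
  have Y: "Y \<in> borel_measurable (past_algebra M X ?n)"
    unfolding Y_def by (intro borel_measurable_prod past_spin_measurable X lt)
  have bd: "\<bar>Y \<omega>\<bar> \<le> 1" if "\<omega> \<in> space M" for \<omega>
  proof -
    have "\<bar>X i \<omega>\<bar> = 1" for i using sp[OF that, of i] by auto
    then show ?thesis unfolding Y_def abs_prod by simp
  qed
  have "moment M X F = (\<integral>\<omega>. X ?n \<omega> * Y \<omega> \<partial>M)"
    unfolding moment_def Y_def using F Max by (subst prod.remove[of F ?n]) auto
  also have "\<dots> = measure_pmf.expectation K (\<lambda>k. \<epsilon> k * (\<integral>\<omega>. X (?n - int k) \<omega> * Y \<omega> \<partial>M))"
    by (rule compatible_moment_step[OF comp Y bd])
  also have "\<dots> = measure_pmf.expectation K (\<lambda>k. \<epsilon> k * moment M X (back_step F k))"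
  proof -
    have "(\<integral>\<omega>. X (?n - int k) \<omega> * Y \<omega> \<partial>M) = moment M X (back_step F k)" for k
      unfolding moment_def
    proof (rule Bochner_Integration.integral_cong[OF refl])
      fix \<omega> assume \<omega>: "\<omega> \<in> space M"
      show "X (?n - int k) \<omega> * Y \<omega> = (\<Prod>i\<in>back_step F k. X i \<omega>)"
      proof (cases "?n - int k \<in> ?G")
        case True
        have "Y \<omega> = X (?n - int k) \<omega> * (\<Prod>i\<in>?G - {?n - int k}. X i \<omega>)"
          unfolding Y_def using F by (intro prod.remove True) auto
        moreover have "?G - {?n - int k} = F - {?n, ?n - int k}" by auto
        moreover have "back_step F k = F - {?n, ?n - int k}"
          unfolding back_step_def by (rule if_P) (rule True)
        moreover have "X (?n - int k) \<omega> * (X (?n - int k) \<omega> * z) = z" for z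
          using sp[OF \<omega>, of "?n - int k"] by auto
        ultimately show ?thesis by (simp only:)
      next
        case False
        then have "back_step F k = insert (?n - int k) ?G"
          unfolding back_step_def by (rule if_not_P)
        then show ?thesis unfolding Y_def using F False by (simp only:) (subst prod.insert, auto)
      qed
    qed
    then show ?thesis by simp
  qed
  finally show ?thesis .
qed

lemma compatible_law_unique:
  assumes M: "compatible M X (linear_kernel \<theta>)" and N: "compatible N Y (linear_kernel \<theta>)"
  shows "law M X = law N Y"
proof (rule law_eqI)
  show pM: "prob_space M" and pN: "prob_space N"
    and X: "\<And>n. X n \<in> measurable M (count_space spins)" and Y: "\<And>n. Y n \<in> measurable N (count_space spins)"
    using M N by (simp_all add: compatible_def)
  fix F :: "int set" assume F: "finite F"
  \<comment> \<open>Halving brings a difference of two numbers in [-1, 1] back under the bound 1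
    demanded by \<open>moment_difference_eq_0\<close>.\<close>
  define d where "d F = (moment M X F - moment N Y F) / 2" for F
  have bX: "\<bar>moment M X F\<bar> \<le> 1" and bY: "\<bar>moment N Y F\<bar> \<le> 1" for F
    by (rule abs_moment_le[OF pM X], rule abs_moment_le[OF pN Y])
  have "d F = 0"
  proof (rule moment_difference_eq_0[OF _ _ _ F])
    show "\<bar>d F\<bar> \<le> 1" for F using bX[of F] bY[of F] by (auto simp: d_def field_simps abs_le_iff)
    show "d {} = 0"
      using prob_space.prob_space[OF pM] prob_space.prob_space[OF pN] by (simp add: d_def moment_def)
    fix F :: "int set" assume F: "finite F" "F \<noteq> {}"
    have i: "integrable K (\<lambda>k. \<epsilon> k * moment M X (back_step F k))" "integrable K (\<lambda>k. \<epsilon> k * moment N Y (back_step F k))"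
      by (rule integrable_pmf_bounded[where B = 1]; simp add: abs_mult bX bY)+
    have "d F = (measure_pmf.expectation K (\<lambda>k. \<epsilon> k * moment M X (back_step F k))
        - measure_pmf.expectation K (\<lambda>k. \<epsilon> k * moment N Y (back_step F k))) / 2"
      unfolding d_def compatible_moment_rec[OF M F] compatible_moment_rec[OF N F] ..
    also have "\<dots> = measure_pmf.expectation K (\<lambda>k. (\<epsilon> k * moment M X (back_step F k) - \<epsilon> k * moment N Y (back_step F k)) / 2)"
      using i by simp
    also have "\<dots> = measure_pmf.expectation K (\<lambda>k. \<epsilon> k * d (back_step F k))"
      by (intro Bochner_Integration.integral_cong) (simp_all add: d_def algebra_simps)
    finally show "d F = measure_pmf.expectation K (\<lambda>k. \<epsilon> k * d (back_step F k))" .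
  qed
  then show "moment M X F = moment N Y F" by (simp add: d_def)
qed

end

subsection \<open>Finite-volume limits\<close>

lemma expectation_nat_pmf_sums:
  fixes f :: "nat \<Rightarrow> real"
  assumes "\<And>k. \<bar>f k\<bar> \<le> B"
  shows "measure_pmf.expectation p f = (\<Sum>k. pmf p k * f k)"
proof -
  have "integrable (measure_pmf p) f" by (rule integrable_pmf_bounded[OF assms])
  then have int: "integrable (count_space UNIV) (\<lambda>k. pmf p k * f k)"
    by (simp add: measure_pmf_eq_density integrable_density)
  have "measure_pmf.expectation p f = (\<integral>k. pmf p k * f k \<partial>count_space UNIV)"
    by (simp add: measure_pmf_eq_density integral_density)
  then show ?thesis by (simp add: integral_count_space_nat[OF int])
qed

definition depends_on :: "'i set \<Rightarrow> ('i \<Rightarrow> 'a) set \<Rightarrow> bool" where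
  "depends_on J S \<longleftrightarrow> (\<forall>x y. (\<forall>j\<in>J. x j = y j) \<longrightarrow> x \<in> S \<longleftrightarrow> y \<in> S)"

lemma depends_on_mono: "depends_on I S \<Longrightarrow> I \<subseteq> J \<Longrightarrow> depends_on J S"
  unfolding depends_on_def by (meson subsetD)

lemma depends_on_Int: "depends_on J S \<Longrightarrow> depends_on J T \<Longrightarrow> depends_on J (S \<inter> T)"
  unfolding depends_on_def Int_iff by blast

lemma depends_on_fun_upd: "depends_on J S \<Longrightarrow> n \<notin> J \<Longrightarrow> x(n := v) \<in> S \<longleftrightarrow> x \<in> S"
proof -
  assume "depends_on J S" "n \<notin> J"
  moreover from this(2) have "\<forall>j\<in>J. (x(n := v)) j = x j" by auto
  ultimately show ?thesis unfolding depends_on_def by blast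
qed

context signed_renewal
begin

text \<open>Step \<open>t\<close> writes the site \<open>t - N\<close>; sites below
  \<open>-N\<close> keep the initial spin 1. Only one lag is drawn per step, so every stage is a
  discrete law although configurations are infinite.\<close>

fun chain :: "nat \<Rightarrow> nat \<Rightarrow> (int \<Rightarrow> real) pmf" where
  "chain N 0 = return_pmf (\<lambda>_. 1)"
| "chain N (Suc t) = bind_pmf (chain N t)
     (\<lambda>x. map_pmf (\<lambda>k. x(int t - int N := \<epsilon> k * x (int t - int N - int k))) K)"

lemma chain_spins: "x \<in> set_pmf (chain N t) \<Longrightarrow> x i \<in> spins"
proof (induction t arbitrary: x i)
  case (Suc t)
  then obtain y k where y: "y \<in> set_pmf (chain N t)" "x = y(int t - int N := \<epsilon> k * y (int t - int N - int k))"
    by auto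
  then show ?case using Suc.IH[OF y(1), of i] Suc.IH[OF y(1), of "int t - int N - int k"] abs_\<epsilon>[of k]
    by (auto simp: spins_cases)
qed (simp add: spins_def)

lemma expectation_chain_Suc:
  fixes f :: "_ \<Rightarrow> real"
  assumes "\<And>x. \<bar>f x\<bar> \<le> B"
  shows "measure_pmf.expectation (chain N (Suc t)) f = measure_pmf.expectation (chain N t)
    (\<lambda>x. measure_pmf.expectation K (\<lambda>k. f (x(int t - int N := \<epsilon> k * x (int t - int N - int k)))))"
  by (simp add: expectation_bind_pmf[OF assms])

lemma chain_stable_Suc:
  assumes "depends_on {..<int t - int N} S"
  shows "measure_pmf.prob (chain N (Suc t)) S = measure_pmf.prob (chain N t) S"
proof -
  have "measure_pmf.prob (chain N (Suc t)) S = measure_pmf.expectation (chain N (Suc t)) (indicator S)"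
    by simp
  also have "\<dots> = measure_pmf.expectation (chain N t) (\<lambda>x. measure_pmf.expectation K
      (\<lambda>k. indicator S (x(int t - int N := \<epsilon> k * x (int t - int N - int k)))))"
    by (rule expectation_chain_Suc[where B = 1]) (simp add: indicator_def)
  also have "\<dots> = measure_pmf.expectation (chain N t) (\<lambda>x. measure_pmf.expectation K (\<lambda>k. indicator S x))"
    using depends_on_fun_upd[OF assms] by (simp add: indicator_def)
  finally show ?thesis by simp
qed

text \<open>Later steps write only sites from \<open>t - N\<close> on, so events about earlier sites
  have reached their final probability.\<close>

lemma chain_stable:
  assumes "t \<le> t'" and S: "depends_on {..<int t - int N} S"
  shows "measure_pmf.prob (chain N t') S = measure_pmf.prob (chain N t) S"
  using assms(1)
proof (induction t' rule: dec_induct)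
  case (step m)
  have "depends_on {..<int m - int N} S" by (rule depends_on_mono[OF S]) (use step in auto)
  from chain_stable_Suc[OF this] step show ?case by simp
qed simp

text \<open>The transition rule holds exactly at every stage that has already written
  \<open>n\<close>. Lags are positive, so the copied site lies before \<open>n\<close> and no longer
  changes.\<close>

lemma chain_step:
  assumes t: "int t - int N = n" "Suc t \<le> T" and S: "depends_on {..<n} S"
  shows "measure_pmf.prob (chain N T) (S \<inter> {x. x n = g}) =
    measure_pmf.expectation K (\<lambda>k. measure_pmf.prob (chain N T) (S \<inter> {x. \<epsilon> k * x (n - int k) = g}))"
proof -
  have "measure_pmf.prob (chain N T) (S \<inter> {x. x n = g}) = measure_pmf.prob (chain N (Suc t)) (S \<inter> {x. x n = g})"
  proof (rule chain_stable)
    have "depends_on {..n} (S \<inter> {x. x n = g})"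
      by (intro depends_on_Int depends_on_mono[OF S]) (auto simp: depends_on_def)
    moreover have "{..n} = {..<int (Suc t) - int N}" using t by auto
    ultimately show "depends_on {..<int (Suc t) - int N} (S \<inter> {x. x n = g})" by simp
  qed (use t in simp)
  also have "\<dots> = measure_pmf.expectation (chain N (Suc t)) (indicator (S \<inter> {x. x n = g}))"
    by simp
  also have "\<dots> = measure_pmf.expectation (chain N t) (\<lambda>x. measure_pmf.expectation K
      (\<lambda>k. indicator (S \<inter> {x. x n = g}) (x(n := \<epsilon> k * x (n - int k)))))"
    unfolding t(1)[symmetric] by (rule expectation_chain_Suc[where B = 1]) (simp add: indicator_def)
  also have "\<dots> = measure_pmf.expectation (chain N t) (\<lambda>x. measure_pmf.expectation K
      (\<lambda>k. indicator (S \<inter> {x. \<epsilon> k * x (n - int k) = g}) x))"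
    using depends_on_fun_upd[OF S] by (simp add: indicator_def)
  also have "\<dots> = measure_pmf.expectation K (\<lambda>k. measure_pmf.prob (chain N t) (S \<inter> {x. \<epsilon> k * x (n - int k) = g}))"
    by (subst expectation_swap_pmf[where B = 1]) (auto simp: indicator_def)
  also have "\<dots> = measure_pmf.expectation K (\<lambda>k. measure_pmf.prob (chain N T) (S \<inter> {x. \<epsilon> k * x (n - int k) = g}))"
  proof (rule integral_cong_AE)
    show "AE k in measure_pmf K. measure_pmf.prob (chain N t) (S \<inter> {x. \<epsilon> k * x (n - int k) = g}) =
        measure_pmf.prob (chain N T) (S \<inter> {x. \<epsilon> k * x (n - int k) = g})"
      unfolding AE_measure_pmf_iff
    proof
      fix k assume "k \<in> set_pmf K"
      with K0 have "n - int k < n" by (auto intro: gr0I)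
      then have "depends_on {..<n} (S \<inter> {x. \<epsilon> k * x (n - int k) = g})"
        by (intro depends_on_Int S) (auto simp: depends_on_def)
      with t show "measure_pmf.prob (chain N t) (S \<inter> {x. \<epsilon> k * x (n - int k) = g}) =
        measure_pmf.prob (chain N T) (S \<inter> {x. \<epsilon> k * x (n - int k) = g})"
        by (intro chain_stable[symmetric]) auto
    qed
  qed auto
  finally show ?thesis .
qed

text \<open>By compactness of the cube of all set functions with values in \<open>[0, 1]\<close>, the finite-volume
  laws have a cluster point. It is only finitely additive.\<close>

lemma limit_content:
  obtains \<phi> :: "(int \<Rightarrow> real) set \<Rightarrow> real" where
    "\<And>S. 0 \<le> \<phi> S" "\<phi> UNIV = 1" "\<And>S T. S \<inter> T = {} \<Longrightarrow> \<phi> (S \<union> T) = \<phi> S + \<phi> T"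
    "\<phi> {x. \<exists>i. x i \<notin> spins} = 0"
    "\<And>n S g. depends_on {..<n} S \<Longrightarrow> \<phi> (S \<inter> {x. x n = g}) =
      measure_pmf.expectation K (\<lambda>k. \<phi> (S \<inter> {x. \<epsilon> k * x (n - int k) = g}))"
proof -
  \<comment> \<open>With \<open>2 * N\<close> steps the written sites are those from
    \<open>-N\<close> to \<open>N - 1\<close>, so each fixed site is eventually among them.\<close>
  define P where "P N S = measure_pmf.prob (chain N (2 * N)) S" for N S
  let ?U = "PiE UNIV (\<lambda>_. {0..1}) :: ((int \<Rightarrow> real) set \<Rightarrow> real) set"
  define F where "F = filtermap P sequentially"
  have ev: "eventually Q F" if "\<And>N. N \<ge> N0 \<Longrightarrow> Q (P N)" for Q N0
    unfolding F_def eventually_filtermap by (rule eventually_sequentiallyI) (rule that)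
  have "compact ?U"
    using compactin_PiE[of "\<lambda>_. euclidean" UNIV "\<lambda>_. {0..1::real}"]
    by (simp add: euclidean_product_topology)
  moreover have "F \<noteq> bot" by (simp add: F_def filtermap_bot_iff)
  moreover have evU: "eventually (\<lambda>f. f \<in> ?U) F" by (rule ev) (simp add: P_def PiE_iff)
  ultimately obtain \<phi> where \<phi>: "\<phi> \<in> ?U" "inf (nhds \<phi>) F \<noteq> bot"
    unfolding compact_filter by blast
  define G where "G = inf (nhds \<phi>) F"
  have G: "G \<noteq> bot" using \<phi> by (simp add: G_def)
  have evG: "eventually Q G" if "eventually Q F" for Q
    using that by (simp add: G_def eventually_inf) (use eventually_True in blast)
  have lim: "((\<lambda>f. f S) \<longlongrightarrow> \<phi> S) G" for S
  proof -
    have cont: "continuous_on UNIV (\<lambda>f :: (int \<Rightarrow> real) set \<Rightarrow> real. f S)" by simp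
    have "((\<lambda>f. f S) \<longlongrightarrow> \<phi> S) (nhds \<phi>)"
    proof (rule topological_tendstoI)
      fix A assume "open A" "\<phi> S \<in> A"
      then show "eventually (\<lambda>f. f S \<in> A) (nhds \<phi>)"
        using open_vimage[OF _ cont, of A] unfolding eventually_nhds
        by (intro exI[of _ "(\<lambda>f. f S) -` A"]) auto
    qed
    then show ?thesis by (rule tendsto_mono[rotated]) (simp add: G_def)
  qed
  show ?thesis
  proof
    show "0 \<le> \<phi> S" for S using \<phi> by (auto simp: PiE_iff)
    show "\<phi> UNIV = 1"
    proof (rule tendsto_unique[OF G lim])
      have "eventually (\<lambda>f. f UNIV = 1) G" by (intro evG ev) (simp add: P_def)
      then show "((\<lambda>f. f UNIV) \<longlongrightarrow> 1) G" by (rule tendsto_eventually)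
    qed
    show "\<phi> {x. \<exists>i. x i \<notin> spins} = 0"
    proof (rule tendsto_unique[OF G lim])
      have "eventually (\<lambda>f. f {x. \<exists>i. x i \<notin> spins} = 0) G"
      proof (intro evG ev)
        fix N
        show "P N {x. \<exists>i. x i \<notin> spins} = 0"
          unfolding P_def by (auto simp: measure_pmf_zero_iff dest: chain_spins)
      qed
      then show "((\<lambda>f. f {x. \<exists>i. x i \<notin> spins}) \<longlongrightarrow> 0) G" by (rule tendsto_eventually)
    qed
    fix S T :: "(int \<Rightarrow> real) set"
    assume "S \<inter> T = {}"
    then have "eventually (\<lambda>f. f (S \<union> T) = f S + f T) G"
      by (intro evG ev) (simp add: P_def measure_pmf.finite_measure_Union)
    then have "((\<lambda>f. f (S \<union> T)) \<longlongrightarrow> \<phi> S + \<phi> T) G"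
      by (rule tendsto_cong[THEN iffD2]) (intro tendsto_intros lim)
    then show "\<phi> (S \<union> T) = \<phi> S + \<phi> T" by (rule tendsto_unique[OF G lim])
  next
    fix n :: int and S :: "(int \<Rightarrow> real) set" and g :: real
    assume S: "depends_on {..<n} S"
    let ?S = "\<lambda>k. S \<inter> {x. \<epsilon> k * x (n - int k) = g}"
    have "eventually (\<lambda>f. f (S \<inter> {x. x n = g}) = (\<Sum>k. pmf K k * f (?S k))) G"
    proof (intro evG ev)
      fix N assume N: "N \<ge> nat \<bar>n\<bar> + 1"
      have "P N (S \<inter> {x. x n = g}) = measure_pmf.expectation K (\<lambda>k. P N (?S k))"
        unfolding P_def using N S by (intro chain_step[of "nat (n + int N)"]) auto
      also have "\<dots> = (\<Sum>k. pmf K k * P N (?S k))"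
        by (rule expectation_nat_pmf_sums[where B = 1]) (simp add: P_def)
      finally show "P N (S \<inter> {x. x n = g}) = (\<Sum>k. pmf K k * P N (?S k))" .
    qed
    note step = this
    \<comment> \<open>The limit must pass through an infinite sum over lags; \<open>pmf K k\<close>
      is a summable majorant valid on the whole cube.\<close>
    have "((\<lambda>f. \<Sum>k. pmf K k * f (?S k)) \<longlongrightarrow> (\<Sum>k. pmf K k * \<phi> (?S k))) G"
    proof -
      have "eventually (\<lambda>f. \<forall>k. norm (pmf K k * f (?S k)) \<le> pmf K k) G"
      proof (rule evG, rule eventually_mono[OF evU])
        fix f assume "f \<in> ?U"
        then have "0 \<le> f X" "f X \<le> 1" for X by (auto simp: PiE_iff)
        then show "\<forall>k. norm (pmf K k * f (?S k)) \<le> pmf K k"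
          by (simp add: abs_mult mult_left_le)
      qed
      then have bound: "eventually (\<lambda>(k, f). norm (pmf K k * f (?S k)) \<le> pmf K k) (at_top \<times>\<^sub>F G)"
        unfolding eventually_prod_filter
        by (intro exI[of _ "\<lambda>_. True"] exI[of _ "\<lambda>f. \<forall>k. norm (pmf K k * f (?S k)) \<le> pmf K k"]) auto
      have "summable (pmf K)"
      proof -
        have "integrable (count_space UNIV) (pmf K)" by (rule integrable_pmf)
        then have "summable (\<lambda>k. norm (pmf K k))" by (simp add: integrable_count_space_nat_iff)
        then show ?thesis by simp
      qed
      with tannerys_theorem[of "\<lambda>k f. pmf K k * f (?S k)", OF tendsto_mult[OF tendsto_const lim] bound _ G]
      show ?thesis by blast
    qed
    then have "((\<lambda>f. f (S \<inter> {x. x n = g})) \<longlongrightarrow> (\<Sum>k. pmf K k * \<phi> (?S k))) G"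
      by (rule tendsto_cong[OF step, THEN iffD2])
    then have "\<phi> (S \<inter> {x. x n = g}) = (\<Sum>k. pmf K k * \<phi> (?S k))"
      by (rule tendsto_unique[OF G lim])
    also have "\<dots> = measure_pmf.expectation K (\<lambda>k. \<phi> (?S k))"
      by (rule expectation_nat_pmf_sums[symmetric, where B = 1]) (use \<phi>(1) in \<open>auto simp: PiE_iff\<close>)
    finally show "\<phi> (S \<inter> {x. x n = g}) = measure_pmf.expectation K (\<lambda>k. \<phi> (?S k))" .
  qed
qed

end

subsection \<open>Existence of a compatible process\<close>

locale spin_content =
  fixes \<phi> :: "('i \<Rightarrow> real) set \<Rightarrow> real"
  assumes nonneg: "\<And>S. 0 \<le> \<phi> S"
    and total: "\<phi> UNIV = 1"
    and additive: "\<And>S T. S \<inter> T = {} \<Longrightarrow> \<phi> (S \<union> T) = \<phi> S + \<phi> T"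
    and nonspins: "\<phi> {x. \<exists>i. x i \<notin> spins} = 0"
begin

lemma content_empty: "\<phi> {} = 0"
  using additive[of "{}" "{}"] by simp

lemma mono: "S \<subseteq> T \<Longrightarrow> \<phi> S \<le> \<phi> T"
  using additive[of S "T - S"] nonneg[of "T - S"] by (simp add: Un_absorb1)

lemma spin_cong:
  assumes "\<And>x. (\<And>i. x i \<in> spins) \<Longrightarrow> x \<in> S \<longleftrightarrow> x \<in> T"
  shows "\<phi> S = \<phi> T"
proof -
  let ?N = "{x. \<exists>i. x i \<notin> spins}"
  have "\<phi> U = \<phi> (U - ?N)" for U
  proof -
    have "\<phi> (U \<inter> ?N) \<le> \<phi> ?N" by (rule mono) auto
    then have "\<phi> (U \<inter> ?N) = 0" using nonspins nonneg[of "U \<inter> ?N"] by simp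
    moreover have "\<phi> ((U - ?N) \<union> (U \<inter> ?N)) = \<phi> (U - ?N) + \<phi> (U \<inter> ?N)" by (rule additive) auto
    moreover have "(U - ?N) \<union> (U \<inter> ?N) = U" by auto
    ultimately show ?thesis by simp
  qed
  moreover have "S - ?N = T - ?N" using assms by auto
  ultimately show ?thesis by metis
qed

lemma sum_fibres:
  assumes "finite B"
  shows "(\<Sum>y\<in>B. \<phi> (h -` {y})) = \<phi> (h -` B)"
  using assms
proof (induction B)
  case empty
  then show ?case by (simp add: content_empty)
next
  case (insert y B)
  have "\<phi> (h -` insert y B) = \<phi> (h -` {y} \<union> h -` B)" by (rule arg_cong[of _ _ \<phi>]) auto
  also have "\<dots> = \<phi> (h -` {y}) + \<phi> (h -` B)" by (rule additive) (use insert in auto)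
  finally show ?case using insert by simp
qed

text \<open>The weights sit on finitely many spin patterns, so finite additivity of \<phi> yields a
  measure. It is carried over to Borel sets because the projective limit is taken with real
  coordinates.\<close>

definition marginal :: "'i set \<Rightarrow> ('i \<Rightarrow> real) measure" where
  "marginal J = distr (point_measure (PiE J (\<lambda>_. spins)) (\<lambda>y. ennreal (\<phi> ((\<lambda>x. restrict x J) -` {y}))))
     (PiM J (\<lambda>_. borel)) (\<lambda>y. y)"

lemma sets_marginal [simp]: "sets (marginal J) = sets (PiM J (\<lambda>_. borel))"
  by (simp add: marginal_def)

lemma space_marginal [simp]: "space (marginal J) = space (PiM J (\<lambda>_. borel))"
  by (simp add: marginal_def)

lemma emeasure_marginal:
  assumes J: "finite J" and A: "A \<in> sets (PiM J (\<lambda>_. borel))"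
  shows "emeasure (marginal J) A = ennreal (\<phi> ((\<lambda>x. restrict x J) -` A))"
proof -
  let ?C = "PiE J (\<lambda>_. spins)" and ?r = "\<lambda>x. restrict x J"
  have fin: "finite ?C" by (rule finite_PiE) (use J in \<open>auto simp: spins_def\<close>)
  have "emeasure (marginal J) A = emeasure (point_measure ?C (\<lambda>y. ennreal (\<phi> (?r -` {y})))) (A \<inter> ?C)"
    unfolding marginal_def
    by (subst emeasure_distr)
       (use A in \<open>auto simp: space_point_measure sets_point_measure measurable_def space_PiM PiE_iff\<close>)
  also have "\<dots> = (\<Sum>y\<in>A \<inter> ?C. ennreal (\<phi> (?r -` {y})))"
    by (rule emeasure_point_measure_finite2) (use fin in auto)
  also have "\<dots> = ennreal (\<phi> (?r -` (A \<inter> ?C)))"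
    using fin nonneg by (simp add: sum_fibres)
  also have "\<phi> (?r -` (A \<inter> ?C)) = \<phi> (?r -` A)"
    by (rule spin_cong) auto
  finally show ?thesis .
qed

lemma polish_projective_marginal: "polish_projective UNIV marginal"
proof (intro polish_projective.intro projective_family.intro)
  fix J H :: "'i set" assume JH: "J \<subseteq> H" "finite H"
  then have J: "finite J" by (rule finite_subset)
  have r: "(\<lambda>f. restrict f J) \<in> measurable (marginal H) (PiM J (\<lambda>_. borel))"
    using measurable_restrict_subset[OF JH(1), of "\<lambda>_. borel"]
    by (simp cong: measurable_cong_sets)
  show "marginal J = distr (marginal H) (PiM J (\<lambda>_. borel)) (\<lambda>f. restrict f J)"
  proof (rule measure_eqI)
    fix A assume "A \<in> sets (marginal J)"
    then have A: "A \<in> sets (PiM J (\<lambda>_. borel))" by simp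
    have pre: "(\<lambda>f. restrict f J) -` A \<inter> space (marginal H) \<in> sets (PiM H (\<lambda>_. borel))"
      using measurable_sets[OF r A] by simp
    have "emeasure (distr (marginal H) (PiM J (\<lambda>_. borel)) (\<lambda>f. restrict f J)) A =
        ennreal (\<phi> ((\<lambda>x. restrict x H) -` ((\<lambda>f. restrict f J) -` A \<inter> space (marginal H))))"
      using emeasure_marginal[OF JH(2) pre] by (subst emeasure_distr[OF r A]) simp
    also have "(\<lambda>x. restrict x H) -` ((\<lambda>f. restrict f J) -` A \<inter> space (marginal H)) = (\<lambda>x. restrict x J) -` A"
      using JH by (auto simp: space_PiM Int_absorb1)
    finally show "emeasure (marginal J) A = emeasure (distr (marginal H) (PiM J (\<lambda>_. borel)) (\<lambda>f. restrict f J)) A"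
      using emeasure_marginal[OF J A] by (simp only:)
  qed simp
next
  fix J :: "'i set" assume J: "finite J"
  show "prob_space (marginal J)"
  proof (rule prob_spaceI)
    have "(\<lambda>x. restrict x J) -` space (PiM J (\<lambda>_. borel :: real measure)) = UNIV"
      by (auto simp: space_PiM)
    then show "emeasure (marginal J) (space (marginal J)) = 1"
      using emeasure_marginal[OF J sets.top] total by simp
  qed
qed

text \<open>A retraction of the reals onto the spins: coordinates of the projective limit are spins
  only almost surely, whereas \<open>compatible\<close> asks for spin values everywhere.\<close>

definition to_spin :: "real \<Rightarrow> real" where
  "to_spin v = (if v = -1 then -1 else 1)"

lemma to_spin_spins [simp]: "to_spin v \<in> spins"
  by (simp add: to_spin_def spins_def)

lemma to_spin_id [simp]: "v \<in> spins \<Longrightarrow> to_spin v = v"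
  by (auto simp: to_spin_def spins_def)

lemma to_spin_measurable [measurable]: "to_spin \<in> measurable borel (count_space spins)"
  unfolding to_spin_def[abs_def] by (rule measurable_If) (auto simp: spins_def)

lemma process_exists:
  obtains M :: "('i \<Rightarrow> real) measure" and X where
    "prob_space M" "\<And>n. X n \<in> measurable M (count_space spins)"
    "\<And>J S. finite J \<Longrightarrow> depends_on J S \<Longrightarrow> {\<omega> \<in> space M. (\<lambda>i. X i \<omega>) \<in> S} \<in> sets M"
    "\<And>J S. finite J \<Longrightarrow> depends_on J S \<Longrightarrow> measure M {\<omega> \<in> space M. (\<lambda>i. X i \<omega>) \<in> S} = \<phi> S"
proof -
  interpret polish_projective UNIV marginal by (rule polish_projective_marginal)
  define X where "X i \<omega> = to_spin (\<omega> i)" for i and \<omega> :: "'i \<Rightarrow> real"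
  have X: "X n \<in> measurable lim (count_space spins)" for n
  proof -
    have "(\<lambda>\<omega>. \<omega> n) \<in> measurable lim borel"
      by (subst measurable_cong_sets[OF sets_lim refl]) (rule measurable_component_singleton, simp)
    from measurable_compose[OF this to_spin_measurable] show ?thesis by (simp add: X_def[abs_def])
  qed
  have space: "space lim = UNIV" by (simp add: space_PiM)
  have *: "{\<omega> \<in> space lim. (\<lambda>i. X i \<omega>) \<in> S} \<in> sets lim \<and> measure lim {\<omega> \<in> space lim. (\<lambda>i. X i \<omega>) \<in> S} = \<phi> S"
    if J: "finite J" and S: "depends_on J S" for J S
  proof -
    let ?C = "PiE J (\<lambda>_. spins)"
    \<comment> \<open>\<open>S\<close> is an arbitrary set; measurability comes from the finiteness
      of its spin patterns on \<open>J\<close>. Functions undefined outside \<open>J\<close>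
      represent these patterns, as \<open>depends_on\<close> permits.\<close>
    define B where "B = {y \<in> ?C. y \<in> S}"
    define c where "c y = (\<lambda>j\<in>J. to_spin (y j))" for y
    have fin: "finite ?C" by (rule finite_PiE) (use J in \<open>auto simp: spins_def\<close>)
    have "PiE J (\<lambda>j. {b j}) = {b}" if "b \<in> B" for b
      by (rule PiE_singleton) (use that in \<open>auto simp: B_def PiE_def\<close>)
    then have "B = (\<Union>b\<in>B. PiE J (\<lambda>j. {b j}))" by auto
    also have "\<dots> \<in> sets (PiM J (\<lambda>_. count_space spins))"
      by (intro sets.finite_UN sets_PiM_I_finite J) (use fin in \<open>auto simp: B_def\<close>)
    finally have B: "B \<in> sets (PiM J (\<lambda>_. count_space spins))" .
    have c: "c \<in> measurable (PiM J (\<lambda>_. borel)) (PiM J (\<lambda>_. count_space spins))"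
      unfolding c_def by measurable
    define A where "A = c -` B \<inter> space (PiM J (\<lambda>_. borel :: real measure))"
    have A: "A \<in> sets (PiM J (\<lambda>_. borel))" unfolding A_def by (rule measurable_sets[OF c B])
    have eqS: "restrict x J \<in> S \<longleftrightarrow> x \<in> S" for x
      using S unfolding depends_on_def by (metis restrict_apply')
    have cr: "c (restrict x J) \<in> B \<longleftrightarrow> (\<lambda>i. to_spin (x i)) \<in> S" for x
    proof -
      have "c (restrict x J) = restrict (\<lambda>i. to_spin (x i)) J" by (auto simp: c_def)
      then show ?thesis using eqS[of "\<lambda>i. to_spin (x i)"] by (auto simp: B_def)
    qed
    have emb: "{\<omega> \<in> space lim. (\<lambda>i. X i \<omega>) \<in> S} = prod_emb UNIV (\<lambda>_. borel) J A"
      using cr by (auto simp: space prod_emb_def A_def X_def space_PiM)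
    have "measure lim (prod_emb UNIV (\<lambda>_. borel) J A) = measure (marginal J) A"
      by (rule measure_lim_emb) (use J A in auto)
    also have "\<dots> = \<phi> ((\<lambda>x. restrict x J) -` A)"
      using emeasure_marginal[OF J A] nonneg by (simp add: measure_def)
    also have "\<dots> = \<phi> S"
    proof (rule spin_cong)
      fix x :: "'i \<Rightarrow> real" assume "\<And>i. x i \<in> spins"
      then have "(\<lambda>i. to_spin (x i)) = x" by auto
      then show "x \<in> (\<lambda>x. restrict x J) -` A \<longleftrightarrow> x \<in> S"
        using cr[of x] by (auto simp: A_def space_PiM)
    qed
    finally show ?thesis
      unfolding emb using measurable_prod_emb[OF subset_UNIV A] by simp
  qed
  show ?thesis
    by (rule that[of lim X]) (use * X P.prob_space_axioms in blast)+
qed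

end

section \<open>Conditional expectations given the past\<close>

text \<open>The measures with densities \<open>f\<close> and \<open>q\<close>, pushed to the history
  space, are equal once they agree on cylinders, and the events of the past algebra are the
  preimages of history events.\<close>

lemma real_cond_exp_pastI:
  fixes f q :: "'a \<Rightarrow> real"
  assumes M: "prob_space M" and X: "\<And>n. X n \<in> measurable M (count_space spins)"
    and f: "f \<in> borel_measurable M" "\<And>\<omega>. \<omega> \<in> space M \<Longrightarrow> 0 \<le> f \<omega> \<and> f \<omega> \<le> 1"
    and q: "q \<in> borel_measurable (past_algebra M X n)" "\<And>\<omega>. \<omega> \<in> space M \<Longrightarrow> 0 \<le> q \<omega> \<and> q \<omega> \<le> 1"
    and cyl: "\<And>J A. finite J \<Longrightarrow> J \<subseteq> {1..} \<Longrightarrow> (\<And>j. j \<in> J \<Longrightarrow> A j \<subseteq> spins) \<Longrightarrow>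
      (\<integral>\<omega>. indicator {\<omega> \<in> space M. \<forall>j\<in>J. X (n - int j) \<omega> \<in> A j} \<omega> * f \<omega> \<partial>M) =
      (\<integral>\<omega>. indicator {\<omega> \<in> space M. \<forall>j\<in>J. X (n - int j) \<omega> \<in> A j} \<omega> * q \<omega> \<partial>M)"
  shows "AE \<omega> in M. real_cond_exp M (past_algebra M X n) f \<omega> = q \<omega>"
proof -
  interpret prob_space M by fact
  let ?F = "past_algebra M X n"
  have sub: "subalgebra M ?F" by (rule subalgebra_past_algebra) (rule X)
  interpret F: finite_measure_subalgebra M ?F by unfold_locales (rule sub)
  have qM: "q \<in> borel_measurable M" by (rule measurable_from_subalg[OF sub q(1)])
  have p: "past X n \<in> measurable M history_space" by (rule measurable_past) (rule X)
  define \<nu> where "\<nu> h = distr (density M (\<lambda>\<omega>. ennreal (h \<omega>))) history_space (past X n)" for h :: "'a \<Rightarrow> real"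
  have \<nu>: "emeasure (\<nu> h) H = ennreal (\<integral>\<omega>. indicator (past X n -` H \<inter> space M) \<omega> * h \<omega> \<partial>M)"
    if H: "H \<in> sets history_space" and h: "h \<in> borel_measurable M" "\<And>\<omega>. \<omega> \<in> space M \<Longrightarrow> 0 \<le> h \<omega> \<and> h \<omega> \<le> 1"
    for H h
  proof -
    have pre: "past X n -` H \<inter> space M \<in> sets M" by (rule measurable_sets[OF p H])
    have "emeasure (\<nu> h) H = (\<integral>\<^sup>+\<omega>. ennreal (h \<omega>) * indicator (past X n -` H \<inter> space M) \<omega> \<partial>M)"
      unfolding \<nu>_def using p h pre by (subst emeasure_distr) (auto simp: H emeasure_density)
    also have "\<dots> = (\<integral>\<^sup>+\<omega>. ennreal (indicator (past X n -` H \<inter> space M) \<omega> * h \<omega>) \<partial>M)"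
      by (intro nn_integral_cong) (auto simp: indicator_def)
    also have "\<dots> = ennreal (\<integral>\<omega>. indicator (past X n -` H \<inter> space M) \<omega> * h \<omega> \<partial>M)"
    proof (intro nn_integral_eq_integral integrable_const_bound[where B = 1])
      show "(\<lambda>\<omega>. indicator (past X n -` H \<inter> space M) \<omega> * h \<omega>) \<in> borel_measurable M"
        by (intro borel_measurable_times borel_measurable_indicator pre h)
    qed (use h in \<open>auto simp: indicator_def\<close>)
    finally show ?thesis .
  qed
  have "\<nu> f = \<nu> q"
  proof (rule measure_eqI_PiM_infinite)
    show "sets (\<nu> f) = sets (PiM {1..} (\<lambda>_. count_space spins))" "sets (\<nu> q) = sets (PiM {1..} (\<lambda>_. count_space spins))"
      by (simp_all add: \<nu>_def history_space_def)
    show "finite_measure (\<nu> f)"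
    proof
      have "emeasure (\<nu> f) (space history_space) \<noteq> \<infinity>" by (simp add: \<nu> f)
      then show "emeasure (\<nu> f) (space (\<nu> f)) \<noteq> \<infinity>" by (simp add: \<nu>_def)
    qed
    fix A and J :: "nat set"
    assume J: "finite J" "J \<subseteq> {1..}" and A: "\<And>i. i \<in> J \<Longrightarrow> A i \<in> sets (count_space spins)"
    let ?E = "prod_emb {1..} (\<lambda>_. count_space spins) J (Pi\<^sub>E J A)"
    have E: "?E \<in> sets history_space"
      unfolding history_space_def by (intro sets_PiM_I) (use J A in auto)
    have "past X n -` ?E \<inter> space M = {\<omega> \<in> space M. \<forall>j\<in>J. X (n - int j) \<omega> \<in> A j}"
      using J measurable_space[OF X] by (auto simp: prod_emb_def past_def PiE_iff subset_iff)
    then show "emeasure (\<nu> f) ?E = emeasure (\<nu> q) ?E"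
      using \<nu>[OF E f] \<nu>[OF E qM q(2)] cyl[OF J, of A] A by simp
  qed
  then have eq: "(\<integral>\<omega>. indicator (past X n -` H \<inter> space M) \<omega> * f \<omega> \<partial>M) =
      (\<integral>\<omega>. indicator (past X n -` H \<inter> space M) \<omega> * q \<omega> \<partial>M)" if H: "H \<in> sets history_space" for H
  proof -
    have nn: "0 \<le> (\<integral>\<omega>. indicator (past X n -` H \<inter> space M) \<omega> * h \<omega> \<partial>M)"
      if "\<And>\<omega>. \<omega> \<in> space M \<Longrightarrow> 0 \<le> h \<omega> \<and> h \<omega> \<le> 1" for h :: "'a \<Rightarrow> real"
      using that by (intro integral_nonneg_AE) (auto simp: indicator_def)
    show ?thesis
      using \<nu>[OF H f] \<nu>[OF H qM q(2)] \<open>\<nu> f = \<nu> q\<close> nn[OF f(2)] nn[OF q(2)] by simp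
  qed
  show ?thesis
  proof (rule F.real_cond_exp_charact)
    show "integrable M f" "integrable M q"
      by (rule integrable_const_bound[where B = 1]; use f q(2) qM in auto)+
    fix S assume "S \<in> sets ?F"
    then obtain H where H: "H \<in> sets history_space" "S = past X n -` H \<inter> space M"
      using measurable_space[OF p] unfolding past_algebra_def
      by (subst (asm) sets_vimage_algebra2) auto
    then show "(\<integral>x\<in>S. f x \<partial>M) = (\<integral>x\<in>S. q x \<partial>M)"
      using eq[OF H(1)] by (simp add: set_lebesgue_integral_def)
  qed (rule q(1))
qed

context linear_chain
begin

text \<open>The kernel at \<open>g\<close> is the probability over lags that the copied spin, with
  its sign, equals \<open>g\<close>. So the step identity of \<phi> is the integrated form of
  compatibility on cylinders of the past.\<close>

lemma compatible_process_exists: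
  obtains M :: "(int \<Rightarrow> real) measure" and X where "compatible M X (linear_kernel \<theta>)"
proof -
  obtain \<phi> :: "(int \<Rightarrow> real) set \<Rightarrow> real" where
    \<phi>: "\<And>S. 0 \<le> \<phi> S" "\<phi> UNIV = 1" "\<And>S T. S \<inter> T = {} \<Longrightarrow> \<phi> (S \<union> T) = \<phi> S + \<phi> T"
      "\<phi> {x. \<exists>i. x i \<notin> spins} = 0"
    and step: "\<And>n S g. depends_on {..<n} S \<Longrightarrow> \<phi> (S \<inter> {x. x n = g}) =
      measure_pmf.expectation K (\<lambda>k. \<phi> (S \<inter> {x. \<epsilon> k * x (n - int k) = g}))"
    by (rule limit_content) blast
  interpret spin_content \<phi> by unfold_locales (fact \<phi>)+
  obtain M :: "(int \<Rightarrow> real) measure" and X where M: "prob_space M"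
    and X: "\<And>n. X n \<in> measurable M (count_space spins)"
    and ev: "\<And>J S. finite J \<Longrightarrow> depends_on J S \<Longrightarrow> {\<omega> \<in> space M. (\<lambda>i. X i \<omega>) \<in> S} \<in> sets M"
    and pr: "\<And>J S. finite J \<Longrightarrow> depends_on J S \<Longrightarrow> measure M {\<omega> \<in> space M. (\<lambda>i. X i \<omega>) \<in> S} = \<phi> S"
    by (rule process_exists) blast
  interpret prob_space M by fact
  have past: "past X n \<in> measurable (past_algebra M X n) history_space" for n
    unfolding past_algebra_def
    by (rule measurable_vimage_algebra1) (use measurable_space[OF measurable_past[of X M n, OF X]] in auto)
  have q_eq: "linear_kernel \<theta> g (past X n \<omega>) =
      measure_pmf.expectation K (\<lambda>k. indicator {\<omega> \<in> space M. \<epsilon> k * X (n - int k) \<omega> = g} \<omega>)"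
    if g: "g \<in> spins" and \<omega>: "\<omega> \<in> space M" for g n \<omega>
  proof -
    have sp: "\<bar>X i \<omega>\<bar> = 1" for i using measurable_space[OF X \<omega>] by (simp add: abs_spin)
    have "linear_kernel \<theta> g (past X n \<omega>) = 1 / 2 + g / 2 * measure_pmf.expectation K (\<lambda>k. \<epsilon> k * X (n - int k) \<omega>)"
      by (rule kernel_past[OF X \<omega>])
    also have "\<dots> = measure_pmf.expectation K (\<lambda>k. 1 / 2 + g / 2 * (\<epsilon> k * X (n - int k) \<omega>))"
      by (subst Bochner_Integration.integral_add)
         (auto intro!: integrable_pmf_bounded[where B = 1] simp: abs_mult sp abs_spin[OF g])
    \<comment> \<open>For spins g and s, (1 + g s) / 2 is the indicator of s = g.\<close>
    also have "\<dots> = measure_pmf.expectation K (\<lambda>k. indicator {\<omega> \<in> space M. \<epsilon> k * X (n - int k) \<omega> = g} \<omega>)"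
    proof (rule Bochner_Integration.integral_cong[OF refl])
      fix k
      have "X (n - int k) \<omega> = 1 \<or> X (n - int k) \<omega> = -1" using sp[of "n - int k"] by linarith
      then show "1 / 2 + g / 2 * (\<epsilon> k * X (n - int k) \<omega>) = indicator {\<omega> \<in> space M. \<epsilon> k * X (n - int k) \<omega> = g} \<omega>"
        using abs_\<epsilon>[of k] g \<omega> by (auto simp: spins_cases)
    qed
    finally show ?thesis .
  qed
  have "AE \<omega> in M. real_cond_exp M (past_algebra M X n) (indicator {\<omega> \<in> space M. X n \<omega> = g}) \<omega>
          = linear_kernel \<theta> g (past X n \<omega>)" if g: "g \<in> spins" for g n
  proof (rule real_cond_exp_pastI[OF M X])
    have Xg: "{\<omega> \<in> space M. c * X i \<omega> = g} \<in> sets M" for c i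
      using spin_process_borel[OF X] by measurable
    from Xg[of 1] show "indicat_real {\<omega> \<in> space M. X n \<omega> = g} \<in> borel_measurable M" by simp
    show "(\<lambda>\<omega>. linear_kernel \<theta> g (past X n \<omega>)) \<in> borel_measurable (past_algebra M X n)"
      by (rule measurable_compose[OF past linear_kernel_measurable[OF abs_summable_\<theta>]])
    show "0 \<le> linear_kernel \<theta> g (past X n \<omega>) \<and> linear_kernel \<theta> g (past X n \<omega>) \<le> 1" if "\<omega> \<in> space M" for \<omega>
    proof -
      have "\<bar>measure_pmf.expectation K (\<lambda>k. \<epsilon> k * X (n - int k) \<omega>)\<bar> \<le> 1"
        using measurable_space[OF X that] by (intro abs_expectation_le) (simp add: abs_mult abs_spin)
      then show ?thesis unfolding kernel_past[OF X that] using g by (auto simp: spins_cases)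
    qed
    fix J :: "nat set" and A :: "nat \<Rightarrow> real set"
    assume J: "finite J" "J \<subseteq> {1..}" and A: "\<And>j. j \<in> J \<Longrightarrow> A j \<subseteq> spins"
    define S where "S = {x :: int \<Rightarrow> real. \<forall>j\<in>J. x (n - int j) \<in> A j}"
    let ?J = "(\<lambda>j. n - int j) ` J"
    have S: "depends_on ?J S" unfolding depends_on_def S_def by auto
    have dep: "depends_on (insert i ?J) (S \<inter> {x. c * x i = g})" for c i
      by (intro depends_on_Int depends_on_mono[OF S]) (auto simp: depends_on_def)
    have set: "{\<omega> \<in> space M. \<forall>j\<in>J. X (n - int j) \<omega> \<in> A j} = {\<omega> \<in> space M. (\<lambda>i. X i \<omega>) \<in> S}"
      by (simp add: S_def)
    \<comment> \<open>The factor \<open>c\<close> serves two events: \<open>c = 1\<close> for the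
      spin at \<open>n\<close>, and \<open>c = \<epsilon> k\<close> for the copied spin.\<close>
    have prS: "(\<integral>\<omega>. indicat_real {\<omega> \<in> space M. (\<lambda>i. X i \<omega>) \<in> S} \<omega> * indicat_real {\<omega> \<in> space M. c * X i \<omega> = g} \<omega> \<partial>M) =
        \<phi> (S \<inter> {x. c * x i = g})" for c i
    proof -
      have "(\<integral>\<omega>. indicat_real {\<omega> \<in> space M. (\<lambda>i. X i \<omega>) \<in> S} \<omega> * indicat_real {\<omega> \<in> space M. c * X i \<omega> = g} \<omega> \<partial>M) =
          (\<integral>\<omega>. indicat_real {\<omega> \<in> space M. (\<lambda>i. X i \<omega>) \<in> S \<inter> {x. c * x i = g}} \<omega> \<partial>M)"
        by (intro Bochner_Integration.integral_cong) (auto simp: indicator_def)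
      also have "\<dots> = measure M {\<omega> \<in> space M. (\<lambda>i. X i \<omega>) \<in> S \<inter> {x. c * x i = g}}"
        using ev[OF _ dep, of i c] J by simp
      also have "\<dots> = \<phi> (S \<inter> {x. c * x i = g})"
        using pr[OF _ dep, of i c] J by simp
      finally show ?thesis .
    qed
    have SM: "{\<omega> \<in> space M. (\<lambda>i. X i \<omega>) \<in> S} \<in> sets M" by (rule ev[OF _ S]) (use J in simp)
    have "(\<integral>\<omega>. indicator {\<omega> \<in> space M. (\<lambda>i. X i \<omega>) \<in> S} \<omega> * indicator {\<omega> \<in> space M. X n \<omega> = g} \<omega> \<partial>M) =
        \<phi> (S \<inter> {x. x n = g})"
      using prS[of 1 n] by simp
    also have "\<dots> = measure_pmf.expectation K (\<lambda>k. \<phi> (S \<inter> {x. \<epsilon> k * x (n - int k) = g}))"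
      by (rule step, rule depends_on_mono[OF S]) (use J in auto)
    also have "\<dots> = measure_pmf.expectation K (\<lambda>k. \<integral>\<omega>. indicator {\<omega> \<in> space M. (\<lambda>i. X i \<omega>) \<in> S} \<omega>
        * indicator {\<omega> \<in> space M. \<epsilon> k * X (n - int k) \<omega> = g} \<omega> \<partial>M)"
      by (simp only: prS)
    also have "\<dots> = (\<integral>\<omega>. measure_pmf.expectation K (\<lambda>k. indicator {\<omega> \<in> space M. (\<lambda>i. X i \<omega>) \<in> S} \<omega>
        * indicator {\<omega> \<in> space M. \<epsilon> k * X (n - int k) \<omega> = g} \<omega>) \<partial>M)"
      by (rule expectation_pmf_swap(1)[symmetric, where B = 1, OF finite_measure_axioms])
         (use SM Xg in \<open>auto intro!: borel_measurable_times borel_measurable_indicator simp: abs_mult indicator_def\<close>)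
    also have "\<dots> = (\<integral>\<omega>. indicator {\<omega> \<in> space M. (\<lambda>i. X i \<omega>) \<in> S} \<omega> * linear_kernel \<theta> g (past X n \<omega>) \<partial>M)"
      by (intro Bochner_Integration.integral_cong) (simp_all only: q_eq[OF g] integral_mult_right_zero)
    finally show "(\<integral>\<omega>. indicator {\<omega> \<in> space M. \<forall>j\<in>J. X (n - int j) \<omega> \<in> A j} \<omega> * indicator {\<omega> \<in> space M. X n \<omega> = g} \<omega> \<partial>M) =
      (\<integral>\<omega>. indicator {\<omega> \<in> space M. \<forall>j\<in>J. X (n - int j) \<omega> \<in> A j} \<omega> * linear_kernel \<theta> g (past X n \<omega>) \<partial>M)"
      unfolding set .
  qed (auto simp: indicator_def)
  with M X have "compatible M X (linear_kernel \<theta>)" by (simp add: compatible_def)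
  then show ?thesis by (rule that)
qed

lemma uniqueness: "uniqueness_holds (linear_kernel \<theta>)"
proof -
  obtain M :: "(int \<Rightarrow> real) measure" and X where M: "compatible M X (linear_kernel \<theta>)"
    by (rule compatible_process_exists)
  have "compatible_laws (linear_kernel \<theta>) = {law M X}"
    using M compatible_law_unique[OF _ M] by (auto simp: compatible_laws_def)
  then show ?thesis by (simp add: uniqueness_holds_def)
qed

end

subsection \<open>The lag distribution\<close>

locale linear_kernel_weights =
  fixes \<theta> :: "nat \<Rightarrow> real"
  assumes has_sum_\<theta>: "((\<lambda>k. \<bar>\<theta> k\<bar>) has_sum 1) {1..}"
begin

text \<open>Nothing is assumed about \<open>\<theta> 0\<close>, so the weight at 0 is set to
  0.\<close>

definition lag :: "nat pmf" where
  "lag = embed_pmf (\<lambda>k. if k = 0 then 0 else \<bar>\<theta> k\<bar>)"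

text \<open>A vanishing weight receives the sign 1, since \<open>signed_renewal\<close> asks for 1
  or -1 at every lag.\<close>

definition lag_sign :: "nat \<Rightarrow> real" where
  "lag_sign k = (if \<theta> k < 0 then -1 else 1)"

lemma nn_integral_weights:
  "(\<integral>\<^sup>+k. ennreal (if k = 0 then 0 else \<bar>\<theta> k\<bar>) \<partial>count_space UNIV) = 1"
proof -
  have "((\<lambda>k. if k = 0 then 0 else \<bar>\<theta> k\<bar>) has_sum 1) UNIV"
    using has_sum_\<theta> by (subst has_sum_cong_neutral[where T = "{1..}" and g = "\<lambda>k. \<bar>\<theta> k\<bar>"]) auto
  then have "(\<lambda>k. if k = 0 then 0 else \<bar>\<theta> k\<bar>) sums 1" by (rule has_sum_imp_sums)
  then show ?thesis
    by (subst nn_integral_count_space_nat, subst suminf_ennreal_eq) auto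
qed

lemma pmf_lag: "pmf lag k = (if k = 0 then 0 else \<bar>\<theta> k\<bar>)"
  unfolding lag_def by (rule pmf_embed_pmf) (auto simp: nn_integral_weights)

lemma set_lag: "set_pmf lag = nonzero_lags \<theta>"
  by (auto simp: set_pmf_iff pmf_lag nonzero_lags_def Suc_le_eq split: if_splits)

lemma prob_lag: "1 \<le> n \<Longrightarrow> measure_pmf.prob lag {n..} = (\<Sum>\<^sub>\<infinity>m\<in>{n..}. \<bar>\<theta> m\<bar>)"
  by (simp add: measure_pmf_conv_infsetsum infsetsum_infsum[OF pmf_abs_summable])
     (rule infsum_cong, simp add: pmf_lag)

lemma linear_kernel_eq:
  assumes w: "\<And>k. 1 \<le> k \<Longrightarrow> \<bar>w k\<bar> \<le> 1"
  shows "linear_kernel \<theta> g w = 1 / 2 + g / 2 * measure_pmf.expectation lag (\<lambda>k. lag_sign k * w k)"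
proof -
  \<comment> \<open>\<open>w 0\<close> is not bounded by the hypothesis; replacing it by 0 gives a
    bounded integrand and keeps the expectation, as the lag is never 0.\<close>
  define v where "v k = (if k = 0 then 0 else w k)" for k
  have v: "\<bar>lag_sign k * v k\<bar> \<le> 1" for k using w[of k] by (simp add: v_def lag_sign_def)
  have int: "integrable (count_space UNIV) (\<lambda>k. pmf lag k * (lag_sign k * v k))"
    using integrable_pmf_bounded[of "\<lambda>k. lag_sign k * v k", OF v, of lag]
    by (simp add: measure_pmf_eq_density integrable_density)
  then have summ: "summable (\<lambda>k. norm (pmf lag k * (lag_sign k * v k)))"
    by (simp add: integrable_count_space_nat_iff)
  have "measure_pmf.expectation lag (\<lambda>k. lag_sign k * w k) = measure_pmf.expectation lag (\<lambda>k. lag_sign k * v k)"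
    by (rule integral_cong_AE) (auto simp: AE_measure_pmf_iff set_lag nonzero_lags_def v_def)
  also have "\<dots> = (\<Sum>k. pmf lag k * (lag_sign k * v k))"
    by (rule expectation_nat_pmf_sums[OF v])
  also have "\<dots> = (\<Sum>\<^sub>\<infinity>k. pmf lag k * (lag_sign k * v k))"
    using summ by (intro infsumI[symmetric] norm_summable_imp_has_sum summable_sums summable_norm_cancel[OF summ])
  also have "\<dots> = (\<Sum>\<^sub>\<infinity>k\<in>{1..}. \<theta> k * w k)"
    by (rule infsum_cong_neutral) (auto simp: pmf_lag lag_sign_def v_def)
  finally show ?thesis by (simp add: linear_kernel_def)
qed

end

theorem theorem2:
  fixes \<theta> :: "nat \<Rightarrow> real"
  assumes "((\<lambda>k. \<bar>\<theta> k\<bar>) has_sum 1) {1..}"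
    and "Gcd (nonzero_lags \<theta>) = 1"
    and "(\<exists>m\<ge>1. even m \<and> \<theta> m < 0) \<or>
         (\<exists>m\<^sub>1\<ge>1. \<exists>m\<^sub>2\<ge>1. odd m\<^sub>1 \<and> \<theta> m\<^sub>1 < 0 \<and> odd m\<^sub>2 \<and> \<theta> m\<^sub>2 > 0)"
    and "(\<lambda>k. (\<Sum>\<^sub>\<infinity>m\<in>{k..}. \<bar>\<theta> m\<bar>)\<^sup>2) summable_on {1..}"
  shows "uniqueness_holds (linear_kernel \<theta>)"
proof -
  interpret linear_kernel_weights \<theta> by unfold_locales (rule assms(1))
  interpret linear_chain lag lag_sign \<theta>
  proof
    show "0 \<notin> set_pmf lag" by (simp add: set_lag nonzero_lags_def)
    show "lag_sign k = 1 \<or> lag_sign k = -1" for k by (simp add: lag_sign_def)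
    show "Gcd (set_pmf lag) = 1" using assms(2) by (simp add: set_lag)
    show "(\<exists>k\<in>set_pmf lag. even k \<and> lag_sign k = - 1) \<or>
      (\<exists>k\<in>set_pmf lag. \<exists>l\<in>set_pmf lag. odd k \<and> lag_sign k = - 1 \<and> odd l \<and> lag_sign l = 1)"
      using assms(3)
    proof (elim disjE exE conjE)
      fix m assume "1 \<le> m" "even m" "\<theta> m < 0"
      then show ?thesis by (intro disjI1 bexI[of _ m]) (auto simp: set_lag nonzero_lags_def lag_sign_def)
    next
      fix k l assume "1 \<le> k" "1 \<le> l" "odd k" "\<theta> k < 0" "odd l" "0 < \<theta> l"
      then show ?thesis
        by (intro disjI2 bexI[of _ k] bexI[of _ l]) (auto simp: set_lag nonzero_lags_def lag_sign_def)
    qed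
    have "(\<lambda>n. (measure_pmf.prob lag {n..})\<^sup>2) summable_on {1..}"
      using assms(4) by (rule summable_on_cong[THEN iffD1, rotated]) (simp add: prob_lag)
    \<comment> \<open>The tails in \<open>signed_renewal\<close> are indexed from 0, which adds a
      single term.\<close>
    then have "(\<lambda>n. (measure_pmf.prob lag {n..})\<^sup>2) summable_on (insert 0 {1..})"
      by (simp add: summable_on_insert_iff)
    also have "insert 0 {1..} = (UNIV :: nat set)" by auto
    finally show "summable (\<lambda>n. (measure_pmf.prob lag {n..})\<^sup>2)" by (rule summable_on_imp_summable)
    show "linear_kernel \<theta> g w = 1 / 2 + g / 2 * measure_pmf.expectation lag (\<lambda>k. lag_sign k * w k)"
      if "\<And>k. 1 \<le> k \<Longrightarrow> \<bar>w k\<bar> \<le> 1" for g w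
      by (rule linear_kernel_eq) (rule that)
    show "(\<lambda>k. \<bar>\<theta> k\<bar>) summable_on {1..}" using assms(1) by (rule has_sum_imp_summable)
  qed
  show ?thesis by (rule uniqueness)
qed

end
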